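(* Let $\mathbb T^2=(\mathbb R/2\pi\mathbb Z)^2$ and $\Omega_1=\mathbb T^2\times(1,2)$. Let $$v_0(x)=\Big(\sin x_2,\ \big(\tfrac{\pi^2+2}{2}\cos(\pi(x_3-1))-1\big)\sin x_1,\ 0\Big),\qquad q_0(x)=\big(\cos(\pi(x_3-1))-1\big)\cos x_1\cos x_2 .$$ Then $\nabla\cdot v_0=0$ in $\Omega_1$, $v_{03}=0$ on $\partial\Omega_1$, and $q_0$ solves the Neumann problem for the Euler pressure at time $0$, namely $\Delta q_0=-\sum_{i,j=1}^3\partial_iv_{0j}\,\partial_jv_{0i}$ in $\Omega_1$ and $\partial_3q_0=0$ on $\{x_3=1\}\cup\{x_3=2\}$; moreover $q_0=0$ on $\mathbb T^2\times\{1\}$, so the pressure (stress) matching condition $q=\partial_N w$ with $w\equiv 0$ holds initially. Let $T>0$ and let $(v,q)$ be a solution on $[0,T]$ of $$v_t+v\cdot\nabla v+\nabla q=0,\quad \nabla\cdot v=0\ \text{ in }\Omega_1,\qquad v_3=0\ \text{ on }\partial\Omega_1,\qquad v(\cdot,0)=v_0,$$ smooth in $(t,x)\in[0,T]\times\overline{\Omega_1}$ and real-analytic in $x$. Then the matching condition is not preserved, even modulo the time-dependent constant in the pressure: there is $t_0\in(0,T]$ such that for every $t\in(0,t_0)$ there is no constant $c(t)\in\mathbb R$ with $$q(t,x_1,x_2,1)+c(t)=0\quad\text{for all }(x_1,x_2)\in\mathbb T^2 .$$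
   Context: Background: in the coupled Euler–wave problem an elastic layer with scalar displacement $w$ (solving $w_{tt}-\Delta w=0$, $w(\cdot,0)=0$) occupies $\mathbb T^2\times(0,1)$ below the fluid domain $\Omega_1$; the interface is $\mathbb T^2\times\{1\}$. The kinematic (velocity) matching condition prescribes the normal fluid velocity at the interface to be $\partial_tw$; the pressure (stress) matching condition is $q=\partial_Nw$ on the interface. If $w_t(\cdot,0)=0$ then $w\equiv0$, the fluid domain is fixed, the kinematic condition becomes $v_3=0$ on $\partial\Omega_1$, and the stress matching condition becomes $q=0$ on $\mathbb T^2\times\{1\}$. The pressure is determined by the Euler system only up to an additive function of time. *)

theory Defs
  imports "HOL-Analysis.Analysis"
begin

text \<open>
  Functions on \<open>\<T>\<^sup>2 \<times> I\<close> are represented on the covering space: they are functions of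
  \<open>x :: real^3\<close> that are \<open>2\<pi>\<close>-periodic in the first two coordinates as long as \<open>x$3 \<in> I\<close>.
  Values outside the closed slab carry no meaning and are never constrained.
\<close>

definition Omega1 :: "(real^3) set" where
  "Omega1 = {x. 1 < x$3 \<and> x$3 < 2}"

definition elastic_layer :: "(real^3) set" where
  "elastic_layer = {x. 0 < x$3 \<and> x$3 < 1}"

definition interface :: "(real^3) set" where
  "interface = {x. x$3 = 1}"

definition torus_periodic_on :: "(real^3) set \<Rightarrow> (real^3 \<Rightarrow> 'b) \<Rightarrow> bool" where
  "torus_periodic_on S f \<longleftrightarrow>
     (\<forall>x\<in>S. f (x + axis 1 (2 * pi)) = f x \<and> f (x + axis 2 (2 * pi)) = f x)"

section \<open>Differential operators\<close>

text \<open>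
  All derivatives are taken within a set \<open>S\<close> (below: a closed slab), so that they are one-sided
  in the direction transversal to the boundary and ordinary ones at interior points.
\<close>

definition partial_within ::
  "(real^3) set \<Rightarrow> 3 \<Rightarrow> (real^3 \<Rightarrow> 'b::real_normed_vector) \<Rightarrow> real^3 \<Rightarrow> 'b" where
  "partial_within S i f x =
     vector_derivative (\<lambda>s. f (x + s *\<^sub>R axis i 1)) (at 0 within {s. x + s *\<^sub>R axis i 1 \<in> S})"

abbreviation pd :: "3 \<Rightarrow> (real^3 \<Rightarrow> 'b::real_normed_vector) \<Rightarrow> real^3 \<Rightarrow> 'b" where
  "pd \<equiv> partial_within (closure Omega1)"

definition divergence :: "(real^3 \<Rightarrow> real^3) \<Rightarrow> real^3 \<Rightarrow> real" where
  "divergence u x = (\<Sum>i\<in>UNIV. pd i (\<lambda>y. u y $ i) x)"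

definition gradient :: "(real^3 \<Rightarrow> real) \<Rightarrow> real^3 \<Rightarrow> real^3" where
  "gradient p x = (\<chi> i. pd i p x)"

definition laplacian :: "(real^3 \<Rightarrow> real) \<Rightarrow> real^3 \<Rightarrow> real" where
  "laplacian p x = (\<Sum>i\<in>UNIV. pd i (pd i p) x)"

definition advection :: "(real^3 \<Rightarrow> real^3) \<Rightarrow> real^3 \<Rightarrow> real^3" where
  "advection u x = (\<Sum>i\<in>UNIV. u x $ i *\<^sub>R pd i u x)"

section \<open>Regularity\<close>

text \<open>
  \<open>C\<^sup>k\<close> up to the boundary. The intended sets \<open>S\<close> are convex with nonempty interior; there the
  derivative within \<open>S\<close> is unique, and the notion coincides with being \<open>C\<^sup>k\<close> in the
  interior with all partial derivatives of order at most \<open>k\<close> extending continuously to \<open>S\<close>.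
\<close>

primrec C_on :: "nat \<Rightarrow> 'a::euclidean_space set \<Rightarrow> ('a \<Rightarrow> 'b::real_normed_vector) \<Rightarrow> bool" where
  "C_on 0 S f \<longleftrightarrow> continuous_on S f"
| "C_on (Suc k) S f \<longleftrightarrow>
     (\<exists>f'. (\<forall>x\<in>S. (f has_derivative f' x) (at x within S)) \<and>
           (\<forall>b\<in>Basis. C_on k S (\<lambda>x. f' x b)))"

definition smooth_on :: "'a::euclidean_space set \<Rightarrow> ('a \<Rightarrow> 'b::real_normed_vector) \<Rightarrow> bool" where
  "smooth_on S f \<longleftrightarrow> (\<forall>k. C_on k S f)"

text \<open>
  Around each point of \<open>S\<close> the function is given on \<open>S\<close> by an (unconditionally) convergent power
  series, indexed by multi-indices. For a closed slab, convergence on the half ball around a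
  boundary point already forces convergence on a full neighbourhood, so this is analyticity up
  to the boundary.
\<close>

definition real_analytic_on ::
  "(real^'n) set \<Rightarrow> (real^'n \<Rightarrow> 'b::real_normed_vector) \<Rightarrow> bool" where
  "real_analytic_on S f \<longleftrightarrow>
     (\<forall>x\<in>S. \<exists>r>0. \<exists>a :: ('n \<Rightarrow> nat) \<Rightarrow> 'b. \<forall>y \<in> S \<inter> ball x r.
        ((\<lambda>\<alpha>. (\<Prod>i\<in>UNIV. (y$i - x$i) ^ \<alpha> i) *\<^sub>R a \<alpha>) has_sum f y) UNIV)"

section \<open>The Euler system and the stress matching condition\<close>

definition euler_solution ::
  "real \<Rightarrow> (real^3 \<Rightarrow> real^3) \<Rightarrow> (real \<Rightarrow> real^3 \<Rightarrow> real^3) \<Rightarrow> (real \<Rightarrow> real^3 \<Rightarrow> real) \<Rightarrow> bool" where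
  "euler_solution T u0 v q \<longleftrightarrow>
     (\<forall>t\<in>{0..T}. torus_periodic_on (closure Omega1) (v t) \<and>
                 torus_periodic_on (closure Omega1) (q t)) \<and>
     (\<forall>t\<in>{0..T}. \<forall>x\<in>Omega1.
        vector_derivative (\<lambda>s. v s x) (at t within {0..T})
          + advection (v t) x + gradient (q t) x = 0 \<and>
        divergence (v t) x = 0) \<and>
     (\<forall>t\<in>{0..T}. \<forall>x\<in>frontier Omega1. v t x $ 3 = 0) \<and>
     (\<forall>x\<in>closure Omega1. v 0 x = u0 x)"

definition regular_solution ::
  "real \<Rightarrow> (real \<Rightarrow> real^3 \<Rightarrow> real^3) \<Rightarrow> (real \<Rightarrow> real^3 \<Rightarrow> real) \<Rightarrow> bool" where
  "regular_solution T v q \<longleftrightarrow>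
     smooth_on ({0..T} \<times> closure Omega1) (\<lambda>(t, x). v t x) \<and>
     smooth_on ({0..T} \<times> closure Omega1) (\<lambda>(t, x). q t x) \<and>
     (\<forall>t\<in>{0..T}. real_analytic_on (closure Omega1) (v t) \<and>
                 real_analytic_on (closure Omega1) (q t))"

text \<open>
  \<open>p = \<partial>\<^sub>N w\<close> on the interface, at a fixed time; \<open>N = (0,0,1)\<close> and \<open>w\<close> lives on the closed
  elastic layer below the interface.
\<close>

definition stress_matching :: "(real^3 \<Rightarrow> real) \<Rightarrow> (real^3 \<Rightarrow> real) \<Rightarrow> bool" where
  "stress_matching p w \<longleftrightarrow>
     (\<forall>x\<in>interface. p x = partial_within (closure elastic_layer) 3 w x)"

section \<open>The initial data\<close>

definition v0 :: "real^3 \<Rightarrow> real^3" where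
  "v0 x = vector [sin (x$2), ((pi\<^sup>2 + 2) / 2 * cos (pi * (x$3 - 1)) - 1) * sin (x$1), 0]"

definition q0 :: "real^3 \<Rightarrow> real" where
  "q0 x = (cos (pi * (x$3 - 1)) - 1) * cos (x$1) * cos (x$2)"

end

theory Submission
  imports Defs
begin

text \<open>
  The vector field \<open>grad \<Psi>\<close> with \<open>\<Psi> = sin x\<^sub>1 sin (2x\<^sub>2) cosh (\<surd>5 (2 - x\<^sub>3))\<close> is divergence free and
  tangential to the top face. Testing the Euler equations with it eliminates the acceleration,
  and the pressure contributes only the interface integral of \<open>q \<partial>\<^sub>3\<Psi>\<close>, which vanishes if \<open>q\<close> is
  constant on the interface. Hence matching at time \<open>t\<close> forces \<open>G(t) = \<integral> v\<cdot>(D\<^sup>2\<Psi>)v = 0\<close>.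

  At time \<open>0\<close> the acceleration is the Leray projection of \<open>- v\<^sub>0\<cdot>\<nabla>v\<^sub>0\<close>, so it is known explicitly, and
  \<open>G'(0) = 2 \<integral> v\<^sub>0\<cdot>(D\<^sup>2\<Psi>) \<partial>\<^sub>tv(0)\<close> is a positive multiple of \<open>\<integral> cos (\<pi>s) cosh (\<surd>5 (1 - s)) ds > 0\<close> over
  \<open>[0,1]\<close>. Therefore \<open>G(t) \<noteq> 0\<close> for small \<open>t > 0\<close>.
\<close>

section \<open>Calculus on the closed slab\<close>

abbreviation slab :: "(real^3) set" where
  "slab \<equiv> closure Omega1"

text \<open>Sliding a point of the closed slab vertically towards the mid-height
  \<open>(a + b) / 2\<close> gives points of the open slab that converge back to it. General
  \<open>a\<close> and \<open>b\<close> serve both the fluid slab and the elastic layer.\<close>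

lemma closure_open_slab:
  fixes a b :: real
  assumes "a < b"
  shows "closure {x :: real^3. a < x$3 \<and> x$3 < b} = {x. a \<le> x$3 \<and> x$3 \<le> b}" (is "closure ?O = ?C")
proof
  have "closed ?C"
    by (intro closed_Collect_conj closed_Collect_le continuous_intros)
  moreover have "?O \<subseteq> ?C" by auto
  ultimately show "closure ?O \<subseteq> ?C" by (simp add: closure_minimal)
next
  show "?C \<subseteq> closure ?O"
  proof
    fix x :: "real^3" assume x: "x \<in> ?C"
    define y where "y = (\<lambda>s. x + (s * ((a + b) / 2 - x$3)) *\<^sub>R axis 3 (1::real))"
    have "y s \<in> ?O" if "s \<in> {0<..<1}" for s
    proof -
      have *: "y s $ 3 = (1 - s) * (x$3) + s * ((a + b) / 2)"
        by (simp add: y_def algebra_simps)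
      have "a = (1 - s) * a + s * a" "b = (1 - s) * b + s * b" by (simp_all add: algebra_simps)
      moreover have "(1 - s) * a \<le> (1 - s) * (x$3)" "(1 - s) * (x$3) \<le> (1 - s) * b"
        using x that by (auto intro: mult_left_mono)
      moreover have "s * a < s * ((a + b) / 2)" "s * ((a + b) / 2) < s * b"
        using assms that by (auto intro!: mult_strict_left_mono)
      ultimately show ?thesis unfolding mem_Collect_eq * by linarith
    qed
    moreover have "(y \<longlongrightarrow> x) (at_right 0)"
      unfolding y_def by (auto intro!: tendsto_eq_intros)
    ultimately show "x \<in> closure ?O"
      by (intro Lim_in_closed_set[of _ y "at_right 0"])
        (auto simp: eventually_at_right_field intro!: exI[of _ 1] subsetD[OF closure_subset])
  qed
qed

lemma slab_eq: "slab = {x. 1 \<le> x$3 \<and> x$3 \<le> 2}"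
  unfolding Omega1_def by (rule closure_open_slab) simp

lemma frontier_Omega1: "frontier Omega1 = {x. x$3 = 1 \<or> x$3 = 2}"
proof -
  have "open Omega1"
    unfolding Omega1_def by (intro open_Collect_conj open_Collect_less continuous_intros)
  then show ?thesis
    unfolding frontier_def slab_eq by (auto simp: interior_open Omega1_def)
qed

text \<open>\<open>vector_derivative\<close> picks a value by choice, so it is determined only along
  a nontrivial filter. Vertically the admissible parameters form a nondegenerate interval containing
  0, even on a face; horizontally they form the whole line.\<close>

lemma at_zero_within_line_neq_bot:
  assumes "a \<le> x$3" "x$3 \<le> b" "a < b"
  shows "at 0 within {s. x + s *\<^sub>R axis i 1 \<in> {x :: real^3. a \<le> x$3 \<and> x$3 \<le> b}} \<noteq> bot"
proof (cases "i = 3")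
  case True
  have "{s. x + s *\<^sub>R axis i 1 \<in> {x :: real^3. a \<le> x$3 \<and> x$3 \<le> b}} = {a - x$3..b - x$3}"
    using True by auto
  then show ?thesis
    using assms by (simp add: trivial_limit_within islimpt_Icc)
next
  case False
  then have "{s. x + s *\<^sub>R axis i 1 \<in> {x :: real^3. a \<le> x$3 \<and> x$3 \<le> b}} = UNIV"
    using assms by (auto simp: axis_def)
  then show ?thesis by simp
qed

text \<open>Chain rule along a straight line. At \<open>s = 0\<close> it yields partial derivatives,
  and along a whole segment the fundamental theorem of calculus.\<close>

lemma has_vector_derivative_line:
  assumes "(f has_derivative f') (at (x + s *\<^sub>R e) within S)" "(\<lambda>s. x + s *\<^sub>R e) ` U \<subseteq> S"
  shows "((\<lambda>s. f (x + s *\<^sub>R e)) has_vector_derivative f' e) (at s within U)"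
proof -
  have "((\<lambda>s. f (x + s *\<^sub>R e)) has_derivative (\<lambda>h. f' (h *\<^sub>R e))) (at s within U)"
  proof (rule has_derivative_in_compose[where g = f and g' = f'])
    show "((\<lambda>s. x + s *\<^sub>R e) has_derivative (\<lambda>h. h *\<^sub>R e)) (at s within U)"
      by (auto intro!: derivative_eq_intros)
    show "(f has_derivative f') (at (x + s *\<^sub>R e) within (\<lambda>s. x + s *\<^sub>R e) ` U)"
      using assms by (rule has_derivative_subset)
  qed
  moreover have "f' (h *\<^sub>R e) = h *\<^sub>R f' e" for h
    using assms(1) by (simp add: has_derivative_def bounded_linear.linear linear_cmul)
  ultimately show ?thesis by (simp add: has_vector_derivative_def)
qed

lemma pd_eqI:
  assumes "(f has_derivative f') (at x within slab)" "x \<in> slab"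
  shows "pd i f x = f' (axis i 1)"
  unfolding partial_within_def
proof (rule vector_derivative_within)
  show "at 0 within {s. x + s *\<^sub>R axis i 1 \<in> slab} \<noteq> bot"
    using assms(2) at_zero_within_line_neq_bot[of 1 x 2 i] by (simp add: slab_eq)
  show "((\<lambda>s. f (x + s *\<^sub>R axis i 1)) has_vector_derivative f' (axis i 1))
          (at 0 within {s. x + s *\<^sub>R axis i 1 \<in> slab})"
    by (rule has_vector_derivative_line[where S = slab]) (use assms in auto)
qed

text \<open>The gradient is carried along as an explicit function, so product and sum rules become
  closure properties, and \<open>pd\<close> is evaluated only where the problem statement mentions
  it.\<close>

definition C1_grad :: "(real^3 \<Rightarrow> real) \<Rightarrow> (real^3 \<Rightarrow> real^3) \<Rightarrow> bool" where
  "C1_grad f g \<longleftrightarrow>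
     (\<forall>x\<in>slab. (f has_derivative (\<lambda>h. h \<bullet> g x)) (at x within slab)) \<and> continuous_on slab g"

lemma C1_gradD:
  assumes "C1_grad f g"
  shows "x \<in> slab \<Longrightarrow> (f has_derivative (\<lambda>h. h \<bullet> g x)) (at x within slab)"
    and "continuous_on slab g" and "continuous_on slab f"
    and "x \<in> slab \<Longrightarrow> pd i f x = g x $ i"
  using assms unfolding C1_grad_def
  by (auto intro: has_derivative_continuous_on simp: pd_eqI inner_axis')

lemma C1_grad_cong:
  assumes "C1_grad f g" "\<And>x. x \<in> slab \<Longrightarrow> f x = f' x" "\<And>x. x \<in> slab \<Longrightarrow> g x = g' x"
  shows "C1_grad f' g'"
proof -
  have "(f' has_derivative (\<lambda>h. h \<bullet> g' x)) (at x within slab)" if "x \<in> slab" for x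
    by (rule has_derivative_transform[OF that _ has_derivative_eq_rhs[OF C1_gradD(1)[OF assms(1) that]]])
       (use assms(2,3) that in auto)
  then show ?thesis
    using C1_gradD(2)[OF assms(1)] assms(3) unfolding C1_grad_def
    by (auto cong: continuous_on_cong)
qed

lemma C1_grad_diff:
  assumes "C1_grad f g" "C1_grad f' g'"
  shows "C1_grad (\<lambda>x. f x - f' x) (\<lambda>x. g x - g' x)"
  using assms unfolding C1_grad_def
  by (auto intro!: derivative_eq_intros continuous_intros simp: inner_diff_right)

lemma C1_grad_mult:
  assumes "C1_grad f g" "C1_grad f' g'"
  shows "C1_grad (\<lambda>x. f x * f' x) (\<lambda>x. f x *\<^sub>R g' x + f' x *\<^sub>R g x)"
proof -
  have "((\<lambda>x. f x * f' x) has_derivative (\<lambda>h. h \<bullet> (f x *\<^sub>R g' x + f' x *\<^sub>R g x))) (at x within slab)"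
    if "x \<in> slab" for x
    using has_derivative_mult[OF assms[THEN C1_gradD(1), OF that]]
    by (simp add: inner_add_right mult.commute)
  moreover have "continuous_on slab (\<lambda>x. f x *\<^sub>R g' x + f' x *\<^sub>R g x)"
    using assms by (intro continuous_intros) (auto dest: C1_gradD)
  ultimately show ?thesis by (simp add: C1_grad_def)
qed

lemma C1_grad_sum:
  assumes "finite I" "\<And>i. i \<in> I \<Longrightarrow> C1_grad (f i) (g i)"
  shows "C1_grad (\<lambda>x. \<Sum>i\<in>I. f i x) (\<lambda>x. \<Sum>i\<in>I. g i x)"
  using assms unfolding C1_grad_def
  by (auto intro!: derivative_eq_intros continuous_intros simp: inner_sum_right)

lemma C1_grad_const: "C1_grad (\<lambda>_. c) (\<lambda>_. 0)"
  by (simp add: C1_grad_def)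

lemma continuous_on_vector_3:
  assumes "continuous_on S a" "continuous_on S b" "continuous_on S c"
  shows "continuous_on S (\<lambda>x. vector [a x, b x, c x] :: real^3)"
proof -
  have "continuous_on S (\<lambda>x. vector [a x, b x, c x] $ i)" for i :: 3
    using exhaust_3[of i] assms by auto
  then show ?thesis
    by (subst vec_lambda_eta[symmetric]) (intro continuous_on_vec_lambda)
qed

text \<open>The components of all explicit fields below are products of one-variable functions, or
  constants, so this product rule differentiates them.\<close>

lemma C1_grad_separated:
  assumes f: "\<And>s. (f has_real_derivative f' s) (at s)" and "continuous_on UNIV f'"
    and g: "\<And>s. (g has_real_derivative g' s) (at s)" and "continuous_on UNIV g'"
    and h: "\<And>s. (h has_real_derivative h' s) (at s)" and "continuous_on UNIV h'"
  shows "C1_grad (\<lambda>x. f (x$1) * g (x$2) * h (x$3))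
    (\<lambda>x. vector [f' (x$1) * g (x$2) * h (x$3), f (x$1) * g' (x$2) * h (x$3), f (x$1) * g (x$2) * h' (x$3)])"
proof -
  have *: "((\<lambda>x. k (x$i)) has_derivative (\<lambda>v. v$i * k' (x$i))) (at x within slab)"
    if "\<And>s. (k has_real_derivative k' s) (at s)" for k k' :: "real \<Rightarrow> real" and i :: 3 and x :: "real^3"
    using has_derivative_compose[OF bounded_linear.has_derivative[OF bounded_linear_vec_nth has_derivative_ident]
        that[of "x$i", unfolded has_field_derivative_def]]
    by (simp add: mult.commute)
  have c: "continuous_on slab (\<lambda>x. k (x$i))" if "continuous_on UNIV k" for k :: "real \<Rightarrow> real" and i :: 3
    by (rule continuous_on_compose2[OF that]) (auto intro!: continuous_intros)
  have cfgh: "continuous_on UNIV f" "continuous_on UNIV g" "continuous_on UNIV h"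
    using f g h by (auto intro!: DERIV_continuous_on)
  have "((\<lambda>x. f (x$1) * g (x$2) * h (x$3)) has_derivative (\<lambda>v. v \<bullet>
      vector [f' (x$1) * g (x$2) * h (x$3), f (x$1) * g' (x$2) * h (x$3), f (x$1) * g (x$2) * h' (x$3)]))
      (at x within slab)" for x :: "real^3"
    by (rule has_derivative_eq_rhs[OF has_derivative_mult[OF has_derivative_mult[OF *[OF f] *[OF g]] *[OF h]]])
       (auto simp: inner_vec_def sum_3 algebra_simps)
  moreover have "continuous_on slab
     (\<lambda>x. vector [f' (x$1) * g (x$2) * h (x$3), f (x$1) * g' (x$2) * h (x$3), f (x$1) * g (x$2) * h' (x$3)] :: real^3)"
    by (rule continuous_on_vector_3) (use assms cfgh in \<open>auto intro!: continuous_intros c\<close>)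
  ultimately show ?thesis by (simp add: C1_grad_def)
qed

section \<open>Integration over a periodicity cell\<close>

text \<open>Nested pairs are used as coordinates because Fubini applies directly to boxes in a
  product type.\<close>

definition pt :: "real \<times> real \<times> real \<Rightarrow> real^3" where
  "pt = (\<lambda>(a, b, c). vector [a, b, c])"

abbreviation cell :: "(real \<times> real \<times> real) set" where
  "cell \<equiv> cbox (0, 0, 1) (2 * pi, 2 * pi, 2)"

definition cell_integral :: "(real^3 \<Rightarrow> real) \<Rightarrow> real" where
  "cell_integral f = integral cell (\<lambda>p. f (pt p))"

lemma pt_nth [simp]: "pt (a, b, c) $ 1 = a" "pt (a, b, c) $ 2 = b" "pt (a, b, c) $ 3 = c"
  by (simp_all add: pt_def)

lemma continuous_on_pt [continuous_intros]: "continuous_on S pt"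
proof -
  have "pt = (\<lambda>p. vector [fst p, fst (snd p), snd (snd p)])"
    by (auto simp: pt_def)
  then show ?thesis
    by (elim ssubst) (intro continuous_on_vector_3 continuous_intros)
qed

lemma pt_in_slab: "pt ` cell \<subseteq> slab"
  by (auto simp: slab_eq cbox_Pair_eq)

lemma continuous_on_pt_cell:
  assumes "continuous_on slab f" "K \<subseteq> cell"
  shows "continuous_on K (\<lambda>p. f (pt p))"
  by (rule continuous_on_compose2[OF assms(1) continuous_on_pt]) (use pt_in_slab assms(2) in auto)

lemma pt_integrable:
  fixes f :: "real^3 \<Rightarrow> real"
  shows "continuous_on slab f \<Longrightarrow> (\<lambda>p. f (pt p)) integrable_on cell"
  by (rule integrable_continuous, rule continuous_on_pt_cell) auto

lemma cell_integral_add: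
  assumes "continuous_on slab f" "continuous_on slab g"
  shows "cell_integral (\<lambda>x. f x + g x) = cell_integral f + cell_integral g"
  unfolding cell_integral_def by (intro integral_add pt_integrable assms)

lemma cell_integral_diff:
  assumes "continuous_on slab f" "continuous_on slab g"
  shows "cell_integral (\<lambda>x. f x - g x) = cell_integral f - cell_integral g"
  unfolding cell_integral_def by (intro integral_diff pt_integrable assms)

lemma cell_integral_cmult: "cell_integral (\<lambda>x. c * f x) = c * cell_integral f"
  unfolding cell_integral_def by simp

lemma cell_integral_cong:
  "(\<And>p. p \<in> cell \<Longrightarrow> f (pt p) = g (pt p)) \<Longrightarrow> cell_integral f = cell_integral g"
  unfolding cell_integral_def by (rule integral_cong)

lemma cell_integral_cong_slab:
  "(\<And>x. x \<in> slab \<Longrightarrow> f x = g x) \<Longrightarrow> cell_integral f = cell_integral g"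
  using pt_in_slab by (intro cell_integral_cong) (simp add: image_subset_iff)

section \<open>Iterated integrals and the divergence theorem on the periodicity cell\<close>

lemma cell_integral_iterated:
  assumes "continuous_on slab f"
  shows "cell_integral f =
    integral {0..2 * pi} (\<lambda>a. integral {0..2 * pi} (\<lambda>b. integral {1..2} (\<lambda>c. f (pt (a, b, c)))))"
proof -
  have "cell_integral f =
      integral {0..2 * pi} (\<lambda>a. integral (cbox (0, 1) (2 * pi, 2)) (\<lambda>r. f (pt (a, r))))"
    unfolding cell_integral_def
    by (simp add: integral_prod_continuous continuous_on_pt_cell[OF assms])
  also have "\<dots> = integral {0..2 * pi} (\<lambda>a. integral {0..2 * pi} (\<lambda>b. integral {1..2} (\<lambda>c. f (pt (a, b, c)))))"
  proof (rule integral_cong)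
    fix a :: real assume "a \<in> {0..2 * pi}"
    then have "continuous_on (cbox (0, 1) (2 * pi, 2)) (\<lambda>r. f (pt (a, r)))"
      by (intro continuous_on_compose2[OF continuous_on_pt_cell[OF assms order_refl]])
         (auto intro!: continuous_intros simp: cbox_Pair_eq)
    from integral_prod_continuous[OF this]
    show "integral (cbox (0, 1) (2 * pi, 2)) (\<lambda>r. f (pt (a, r))) =
        integral {0..2 * pi} (\<lambda>b. integral {1..2} (\<lambda>c. f (pt (a, b, c))))"
      by simp
  qed
  finally show ?thesis .
qed

text \<open>The orders of integration differ so that the innermost variable can be the one in which
  a partial derivative is integrated out: here the second, in the next lemma the first.\<close>

lemma cell_integral_iterated_swap2:
  assumes "continuous_on slab f"
  shows "cell_integral f =
    integral {0..2 * pi} (\<lambda>a. integral {1..2} (\<lambda>c. integral {0..2 * pi} (\<lambda>b. f (pt (a, b, c)))))"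
  unfolding cell_integral_iterated[OF assms]
proof (rule integral_cong)
  fix a :: real assume "a \<in> {0..2 * pi}"
  then have "continuous_on (cbox (0, 1) (2 * pi, 2)) (\<lambda>(b, c). f (pt (a, b, c)))"
    unfolding case_prod_beta
    by (intro continuous_on_compose2[OF continuous_on_pt_cell[OF assms order_refl]])
       (auto intro!: continuous_intros simp: cbox_Pair_eq)
  from integral_swap_continuous[OF this]
  show "integral {0..2 * pi} (\<lambda>b. integral {1..2} (\<lambda>c. f (pt (a, b, c)))) =
      integral {1..2} (\<lambda>c. integral {0..2 * pi} (\<lambda>b. f (pt (a, b, c))))"
    by simp
qed

lemma cell_integral_iterated_swap1:
  assumes "continuous_on slab f"
  shows "cell_integral f =
    integral (cbox (0, 1) (2 * pi, 2)) (\<lambda>r. integral {0..2 * pi} (\<lambda>a. f (pt (a, r))))"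
proof -
  have *: "continuous_on cell (\<lambda>(a, r). f (pt (a, r)))"
    using continuous_on_pt_cell[OF assms order_refl] by (simp add: case_prod_beta)
  show ?thesis
    unfolding cell_integral_def
    using integral_prod_continuous[OF *] integral_swap_continuous[OF *]
    by (simp add: case_prod_beta')
qed

lemma integral_along_line:
  assumes "C1_grad f g" "\<And>s. s \<in> {lo..hi} \<Longrightarrow> x + s *\<^sub>R axis i 1 \<in> slab" "lo \<le> hi"
  shows "integral {lo..hi} (\<lambda>s. g (x + s *\<^sub>R axis i 1) $ i)
    = f (x + hi *\<^sub>R axis i 1) - f (x + lo *\<^sub>R axis i 1)"
proof (intro integral_unique fundamental_theorem_of_calculus assms(3))
  fix s assume "s \<in> {lo..hi}"
  then show "((\<lambda>s. f (x + s *\<^sub>R axis i 1)) has_vector_derivative g (x + s *\<^sub>R axis i 1) $ i) (at s within {lo..hi})"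
    using has_vector_derivative_line[OF C1_gradD(1)[OF assms(1,2)], of s "{lo..hi}"] assms(2)
    by (simp add: image_subset_iff inner_axis')
qed

lemma pt_add_axis:
  "pt (0, b, c) + axis 1 s = pt (s, b, c)"
  "pt (a, 0, c) + axis 2 s = pt (a, s, c)"
  "pt (a, b, 0) + axis 3 s = pt (a, b, s)"
  by (simp_all add: pt_def vec_eq_iff forall_3 axis_def)

lemma scaleR_axis: "s *\<^sub>R axis i (1::real) = axis i s"
  by (simp add: vec_eq_iff axis_def)

text \<open>Integrating first in direction \<open>i\<close> leaves the difference of
  \<open>f\<close> at two points one period apart.\<close>

lemma cell_integral_partial_periodic:
  assumes "C1_grad f g" "torus_periodic_on slab f" "i \<noteq> 3"
  shows "cell_integral (\<lambda>x. g x $ i) = 0"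
proof -
  have c: "continuous_on slab (\<lambda>x. g x $ i)"
    using C1_gradD(2)[OF assms(1)] by (intro continuous_intros)
  consider "i = 1" | "i = 2" using exhaust_3[of i] assms(3) by blast
  then show ?thesis
  proof cases
    case 1
    have "integral {0..2 * pi} (\<lambda>a. g (pt (a, b, c)) $ i) = 0" if "1 \<le> c" "c \<le> 2" for b c
    proof -
      have "f (pt (0, b, c) + axis 1 (2 * pi)) = f (pt (0, b, c))"
        using assms(2) that by (simp add: torus_periodic_on_def slab_eq)
      then show ?thesis
        using integral_along_line[OF assms(1), of 0 "2 * pi" "pt (0, b, c)" 1] that
        by (simp add: 1 slab_eq scaleR_axis pt_add_axis)
    qed
    then show ?thesis
      unfolding cell_integral_iterated_swap1[OF c]
      by (subst integral_cong[where g = "\<lambda>_. 0"]) (auto simp: cbox_Pair_eq)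
  next
    case 2
    have "integral {0..2 * pi} (\<lambda>b. g (pt (a, b, c)) $ i) = 0" if "1 \<le> c" "c \<le> 2" for a c
    proof -
      have "f (pt (a, 0, c) + axis 2 (2 * pi)) = f (pt (a, 0, c))"
        using assms(2) that by (simp add: torus_periodic_on_def slab_eq)
      then show ?thesis
        using integral_along_line[OF assms(1), of 0 "2 * pi" "pt (a, 0, c)" 2] that
        by (simp add: 2 slab_eq scaleR_axis pt_add_axis)
    qed
    then show ?thesis
      unfolding cell_integral_iterated_swap2[OF c]
      by (subst integral_cong[where g = "\<lambda>_. integral {1..2} (\<lambda>_. 0)"]) (auto intro!: integral_cong)
  qed
qed

lemma cell_integral_partial_3:
  assumes "C1_grad f g"
  shows "cell_integral (\<lambda>x. g x $ 3) =
    integral {0..2 * pi} (\<lambda>a. integral {0..2 * pi} (\<lambda>b. f (pt (a, b, 2)) - f (pt (a, b, 1))))"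
proof -
  have c: "continuous_on slab (\<lambda>x. g x $ 3)"
    using C1_gradD(2)[OF assms(1)] by (intro continuous_intros)
  have "integral {1..2} (\<lambda>c. g (pt (a, b, c)) $ 3) = f (pt (a, b, 2)) - f (pt (a, b, 1))" for a b
    using integral_along_line[OF assms(1), of 1 2 "pt (a, b, 0)" 3]
    by (simp add: slab_eq scaleR_axis pt_add_axis)
  then show ?thesis
    unfolding cell_integral_iterated[OF c] by simp
qed

text \<open>Gauss' theorem: the four lateral faces cancel by periodicity, and only the fluxes
  through top and bottom remain.\<close>

lemma cell_integral_divergence:
  assumes "\<And>i. C1_grad (\<lambda>x. u x $ i) (g i)" "torus_periodic_on slab u"
  shows "cell_integral (\<lambda>x. \<Sum>i\<in>UNIV. g i x $ i) =
    integral {0..2 * pi} (\<lambda>a. integral {0..2 * pi} (\<lambda>b. u (pt (a, b, 2)) $ 3 - u (pt (a, b, 1)) $ 3))"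
proof -
  have c: "continuous_on slab (\<lambda>x. g i x $ i)" for i
    using C1_gradD(2)[OF assms(1)] by (intro continuous_intros)
  have p: "torus_periodic_on slab (\<lambda>x. u x $ i)" for i
    using assms(2) by (simp add: torus_periodic_on_def)
  have "cell_integral (\<lambda>x. \<Sum>i\<in>UNIV. g i x $ i) =
      cell_integral (\<lambda>x. g 1 x $ 1) + cell_integral (\<lambda>x. g 2 x $ 2) + cell_integral (\<lambda>x. g 3 x $ 3)"
    unfolding sum_3 by (simp add: cell_integral_add c continuous_on_add)
  then show ?thesis
    using cell_integral_partial_periodic[OF assms(1) p] cell_integral_partial_3[OF assms(1)] by simp
qed

text \<open>Gauss' theorem for the field \<open>\<phi> x *\<^sub>R u x\<close>, i.e. integration by
  parts.\<close>

lemma cell_integral_weighted_divergence: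
  assumes "\<And>i. C1_grad (\<lambda>x. u x $ i) (g i)" "torus_periodic_on slab u"
    and "C1_grad \<phi> d" "torus_periodic_on slab \<phi>"
  shows "cell_integral (\<lambda>x. (\<Sum>i\<in>UNIV. g i x $ i) * \<phi> x + u x \<bullet> d x) =
    integral {0..2 * pi} (\<lambda>a. integral {0..2 * pi} (\<lambda>b.
      \<phi> (pt (a, b, 2)) * u (pt (a, b, 2)) $ 3 - \<phi> (pt (a, b, 1)) * u (pt (a, b, 1)) $ 3))"
proof -
  have "cell_integral (\<lambda>x. \<Sum>i\<in>UNIV. (\<phi> x *\<^sub>R g i x + (u x $ i) *\<^sub>R d x) $ i) =
      integral {0..2 * pi} (\<lambda>a. integral {0..2 * pi} (\<lambda>b.
      (\<phi> (pt (a, b, 2)) *\<^sub>R u (pt (a, b, 2))) $ 3 - (\<phi> (pt (a, b, 1)) *\<^sub>R u (pt (a, b, 1))) $ 3))"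
    by (rule cell_integral_divergence[where u = "\<lambda>x. \<phi> x *\<^sub>R u x" and g = "\<lambda>i x. \<phi> x *\<^sub>R g i x + (u x $ i) *\<^sub>R d x" for g])
       (use C1_grad_mult[OF assms(3) assms(1)] assms(2,4) in \<open>auto simp: torus_periodic_on_def\<close>)
  then show ?thesis
    by (simp add: sum.distrib sum_distrib_left sum_distrib_right inner_vec_def mult.commute)
qed

text \<open>The orthogonality in the Helmholtz decomposition: after integration by parts, the
  divergence kills the interior term and tangency kills the face terms.\<close>

lemma cell_integral_solenoidal:
  assumes "\<And>i. C1_grad (\<lambda>x. u x $ i) (g i)" "torus_periodic_on slab u"
    and "\<And>x. x \<in> slab \<Longrightarrow> (\<Sum>i\<in>UNIV. g i x $ i) = 0" "\<And>x. x \<in> frontier Omega1 \<Longrightarrow> u x $ 3 = 0"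
    and "C1_grad \<phi> d" "torus_periodic_on slab \<phi>"
  shows "cell_integral (\<lambda>x. u x \<bullet> d x) = 0"
proof -
  have "cell_integral (\<lambda>x. u x \<bullet> d x) = cell_integral (\<lambda>x. (\<Sum>i\<in>UNIV. g i x $ i) * \<phi> x + u x \<bullet> d x)"
    by (rule cell_integral_cong_slab) (simp add: assms(3))
  then show ?thesis
    using cell_integral_weighted_divergence[OF assms(1,2,5,6)] assms(4) by (simp add: frontier_Omega1)
qed

lemma cell_integral_separated:
  assumes "continuous_on UNIV f" "continuous_on UNIV g" "continuous_on UNIV h"
  shows "cell_integral (\<lambda>x. f (x$1) * g (x$2) * h (x$3)) =
    integral {0..2 * pi} f * integral {0..2 * pi} g * integral {1..2} h"
proof -
  have c: "continuous_on slab (\<lambda>x. k (x$i))" if "continuous_on UNIV k" for k :: "real \<Rightarrow> real" and i :: 3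
    by (rule continuous_on_compose2[OF that]) (auto intro!: continuous_intros)
  show ?thesis
    by (subst cell_integral_iterated) (use assms in \<open>auto intro!: continuous_intros c\<close>)
qed

lemma cell_integral_sq_eq_0:
  fixes d :: "real^3 \<Rightarrow> real^3"
  assumes "continuous_on slab d" "cell_integral (\<lambda>x. d x \<bullet> d x) = 0" "p \<in> cell"
  shows "d (pt p) = 0"
proof -
  have "continuous_on slab (\<lambda>x. d x \<bullet> d x)"
    using assms(1) by (intro continuous_intros)
  then have "continuous_on cell (\<lambda>p. d (pt p) \<bullet> d (pt p))"
    "((\<lambda>p. d (pt p) \<bullet> d (pt p)) has_integral 0) cell"
    using assms(2) pt_integrable[of "\<lambda>x. d x \<bullet> d x"] continuous_on_pt_cell[of "\<lambda>x. d x \<bullet> d x" cell]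
    by (auto simp: cell_integral_def has_integral_integral)
  then show ?thesis
    using has_integral_0_cbox_imp_0[of _ _ "\<lambda>p. d (pt p) \<bullet> d (pt p)" p] assms(3) by (auto simp: box_ne_empty Basis_prod_def)
qed

section \<open>The initial data and the test function\<close>

lemma C1_grad_v0:
  "C1_grad (\<lambda>x. v0 x $ 1) (\<lambda>x. vector [0, cos (x$2), 0])"
  "C1_grad (\<lambda>x. v0 x $ 2) (\<lambda>x. vector
     [((pi\<^sup>2 + 2) / 2 * cos (pi * (x$3 - 1)) - 1) * cos (x$1), 0,
      - (pi\<^sup>2 + 2) / 2 * pi * sin (pi * (x$3 - 1)) * sin (x$1)])"
  "C1_grad (\<lambda>x. v0 x $ 3) (\<lambda>x. 0)"
proof -
  \<comment> \<open>Constant factors 1 put the function into the shape required by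
    \<open>C1_grad_separated\<close>; \<open>C1_grad_cong\<close> removes them again.\<close>
  have "C1_grad (\<lambda>x. 1 * sin (x$2) * 1) (\<lambda>x. vector [0 * sin (x$2) * 1, 1 * cos (x$2) * 1, 1 * sin (x$2) * 0])"
    by (rule C1_grad_separated) (auto intro!: derivative_eq_intros continuous_intros)
  then show "C1_grad (\<lambda>x. v0 x $ 1) (\<lambda>x. vector [0, cos (x$2), 0])"
    by (rule C1_grad_cong) (auto simp: v0_def)
  have "C1_grad (\<lambda>x. sin (x$1) * 1 * ((pi\<^sup>2 + 2) / 2 * cos (pi * (x$3 - 1)) - 1))
     (\<lambda>x. vector [cos (x$1) * 1 * ((pi\<^sup>2 + 2) / 2 * cos (pi * (x$3 - 1)) - 1),
        sin (x$1) * 0 * ((pi\<^sup>2 + 2) / 2 * cos (pi * (x$3 - 1)) - 1),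
        sin (x$1) * 1 * (- (pi\<^sup>2 + 2) / 2 * pi * sin (pi * (x$3 - 1)))])"
    by (rule C1_grad_separated) (auto intro!: derivative_eq_intros continuous_intros simp: algebra_simps)
  then show "C1_grad (\<lambda>x. v0 x $ 2) (\<lambda>x. vector
     [((pi\<^sup>2 + 2) / 2 * cos (pi * (x$3 - 1)) - 1) * cos (x$1), 0,
      - (pi\<^sup>2 + 2) / 2 * pi * sin (pi * (x$3 - 1)) * sin (x$1)])"
    by (rule C1_grad_cong) (auto simp: v0_def mult_ac)
  show "C1_grad (\<lambda>x. v0 x $ 3) (\<lambda>x. 0)"
    by (rule C1_grad_cong[OF C1_grad_const[of 0]]) (auto simp: v0_def)
qed

definition grad_q0 :: "real^3 \<Rightarrow> real^3" where
  "grad_q0 x = vector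
     [- (cos (pi * (x$3 - 1)) - 1) * sin (x$1) * cos (x$2),
      - (cos (pi * (x$3 - 1)) - 1) * cos (x$1) * sin (x$2),
      - pi * sin (pi * (x$3 - 1)) * cos (x$1) * cos (x$2)]"

lemma C1_grad_q0: "C1_grad q0 grad_q0"
proof -
  have "C1_grad (\<lambda>x. cos (x$1) * cos (x$2) * (cos (pi * (x$3 - 1)) - 1))
     (\<lambda>x. vector [- sin (x$1) * cos (x$2) * (cos (pi * (x$3 - 1)) - 1),
        cos (x$1) * - sin (x$2) * (cos (pi * (x$3 - 1)) - 1),
        cos (x$1) * cos (x$2) * (- pi * sin (pi * (x$3 - 1)))])"
    by (rule C1_grad_separated) (auto intro!: derivative_eq_intros continuous_intros)
  then show ?thesis
    by (rule C1_grad_cong) (auto simp: q0_def grad_q0_def algebra_simps)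
qed

lemma pd_grad_q0:
  assumes "x \<in> slab"
  shows "pd 1 (\<lambda>x. grad_q0 x $ 1) x = - (cos (pi * (x$3 - 1)) - 1) * cos (x$1) * cos (x$2)"
    and "pd 2 (\<lambda>x. grad_q0 x $ 2) x = - (cos (pi * (x$3 - 1)) - 1) * cos (x$1) * cos (x$2)"
    and "pd 3 (\<lambda>x. grad_q0 x $ 3) x = - (pi\<^sup>2) * cos (pi * (x$3 - 1)) * cos (x$1) * cos (x$2)"
proof -
  have "C1_grad (\<lambda>x. sin (x$1) * cos (x$2) * (1 - cos (pi * (x$3 - 1))))
     (\<lambda>x. vector [cos (x$1) * cos (x$2) * (1 - cos (pi * (x$3 - 1))),
        sin (x$1) * - sin (x$2) * (1 - cos (pi * (x$3 - 1))),
        sin (x$1) * cos (x$2) * (pi * sin (pi * (x$3 - 1)))])"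
    by (rule C1_grad_separated) (auto intro!: derivative_eq_intros continuous_intros)
  then have "C1_grad (\<lambda>x. grad_q0 x $ 1) (\<lambda>x. vector [cos (x$1) * cos (x$2) * (1 - cos (pi * (x$3 - 1))),
        sin (x$1) * - sin (x$2) * (1 - cos (pi * (x$3 - 1))),
        sin (x$1) * cos (x$2) * (pi * sin (pi * (x$3 - 1)))])"
    by (rule C1_grad_cong) (auto simp: grad_q0_def algebra_simps)
  from C1_gradD(4)[OF this assms]
  show "pd 1 (\<lambda>x. grad_q0 x $ 1) x = - (cos (pi * (x$3 - 1)) - 1) * cos (x$1) * cos (x$2)"
    by (simp add: algebra_simps)
  have "C1_grad (\<lambda>x. cos (x$1) * sin (x$2) * (1 - cos (pi * (x$3 - 1))))
     (\<lambda>x. vector [- sin (x$1) * sin (x$2) * (1 - cos (pi * (x$3 - 1))),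
        cos (x$1) * cos (x$2) * (1 - cos (pi * (x$3 - 1))),
        cos (x$1) * sin (x$2) * (pi * sin (pi * (x$3 - 1)))])"
    by (rule C1_grad_separated) (auto intro!: derivative_eq_intros continuous_intros)
  then have "C1_grad (\<lambda>x. grad_q0 x $ 2) (\<lambda>x. vector [- sin (x$1) * sin (x$2) * (1 - cos (pi * (x$3 - 1))),
        cos (x$1) * cos (x$2) * (1 - cos (pi * (x$3 - 1))),
        cos (x$1) * sin (x$2) * (pi * sin (pi * (x$3 - 1)))])"
    by (rule C1_grad_cong) (auto simp: grad_q0_def algebra_simps)
  from C1_gradD(4)[OF this assms]
  show "pd 2 (\<lambda>x. grad_q0 x $ 2) x = - (cos (pi * (x$3 - 1)) - 1) * cos (x$1) * cos (x$2)"
    by (simp add: algebra_simps)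
  have "C1_grad (\<lambda>x. cos (x$1) * cos (x$2) * (- pi * sin (pi * (x$3 - 1))))
     (\<lambda>x. vector [- sin (x$1) * cos (x$2) * (- pi * sin (pi * (x$3 - 1))),
        cos (x$1) * - sin (x$2) * (- pi * sin (pi * (x$3 - 1))),
        cos (x$1) * cos (x$2) * (- (pi\<^sup>2) * cos (pi * (x$3 - 1)))])"
    by (rule C1_grad_separated) (auto intro!: derivative_eq_intros continuous_intros simp: power2_eq_square)
  then have "C1_grad (\<lambda>x. grad_q0 x $ 3) (\<lambda>x. vector [- sin (x$1) * cos (x$2) * (- pi * sin (pi * (x$3 - 1))),
        cos (x$1) * - sin (x$2) * (- pi * sin (pi * (x$3 - 1))),
        cos (x$1) * cos (x$2) * (- (pi\<^sup>2) * cos (pi * (x$3 - 1)))])"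
    by (rule C1_grad_cong) (auto simp: grad_q0_def algebra_simps)
  from C1_gradD(4)[OF this assms]
  show "pd 3 (\<lambda>x. grad_q0 x $ 3) x = - (pi\<^sup>2) * cos (pi * (x$3 - 1)) * cos (x$1) * cos (x$2)"
    by (simp add: algebra_simps)
qed

text \<open>The difference quotients only see points of the slab. This permits replacing an inner
  \<open>pd i q0\<close> by a component of \<open>grad_q0\<close>, an identity known on the slab
  only.\<close>

lemma pd_cong:
  assumes "\<And>y. y \<in> slab \<Longrightarrow> f y = g y" "x \<in> slab"
  shows "pd i f x = pd i g x"
proof -
  have "((\<lambda>s. f (x + s *\<^sub>R axis i 1)) has_vector_derivative d) (at 0 within {s. x + s *\<^sub>R axis i 1 \<in> slab})
    \<longleftrightarrow> ((\<lambda>s. g (x + s *\<^sub>R axis i 1)) has_vector_derivative d) (at 0 within {s. x + s *\<^sub>R axis i 1 \<in> slab})" for d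
    by (rule has_vector_derivative_cong_ev) (use assms in auto)
  then show ?thesis
    unfolding partial_within_def vector_derivative_def by simp
qed

lemma divergence_v0:
  assumes "x \<in> slab"
  shows "divergence v0 x = 0"
  unfolding divergence_def sum_3
  by (simp add: C1_grad_v0[THEN C1_gradD(4)] assms)

text \<open>Write A for the \<open>x$3\<close>-dependent coefficient in the second component of
  \<open>v0\<close>. Only the index pairs (1,2) and (2,1) contribute on the right, giving -2 A cos
  x1 cos x2. The amplitude \<open>(pi\<^sup>2 + 2) / 2\<close> and the shift -1 in A make the
  Laplacian agree with this.\<close>

lemma laplacian_q0:
  assumes "x \<in> slab"
  shows "laplacian q0 x = - (\<Sum>i\<in>UNIV. \<Sum>j\<in>UNIV. pd i (\<lambda>y. v0 y $ j) x * pd j (\<lambda>y. v0 y $ i) x)"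
proof -
  have "pd i (pd i q0) x = pd i (\<lambda>x. grad_q0 x $ i) x" for i
    by (rule pd_cong) (use C1_grad_q0 assms in \<open>auto dest: C1_gradD(4)\<close>)
  then have "laplacian q0 x = - 2 * (((pi\<^sup>2 + 2) / 2 * cos (pi * (x$3 - 1)) - 1) * cos (x$1)) * cos (x$2)"
    by (simp add: laplacian_def sum_3 pd_grad_q0[OF assms] field_simps)
  then show ?thesis
    unfolding sum_3 by (simp add: C1_grad_v0[THEN C1_gradD(4)] assms)
qed

section \<open>The harmonic test function\<close>

text \<open>Solution of y'' = 5 y with y'(2) = 0. The constant 5 = 1 + 4 is the sum of the squared
  horizontal frequencies of \<open>\<Psi>\<close>, which makes \<open>\<Psi>\<close> harmonic; the
  condition at 2 makes its gradient tangential to the top face.\<close>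

definition \<psi> :: "real \<Rightarrow> real" where
  "\<psi> s = cosh (sqrt 5 * (2 - s))"

definition \<psi>' :: "real \<Rightarrow> real" where
  "\<psi>' s = - sqrt 5 * sinh (sqrt 5 * (2 - s))"

lemma DERIV_\<psi>: "(\<psi> has_real_derivative \<psi>' s) (at s)"
  unfolding \<psi>_def \<psi>'_def by (auto intro!: derivative_eq_intros)

lemma DERIV_\<psi>': "(\<psi>' has_real_derivative 5 * \<psi> s) (at s)"
  unfolding \<psi>_def \<psi>'_def by (auto intro!: derivative_eq_intros)

lemma continuous_\<psi>: "continuous_on UNIV \<psi>" "continuous_on UNIV \<psi>'"
  using DERIV_\<psi> DERIV_\<psi>' by (auto intro!: DERIV_continuous_on)

text \<open>The frequencies 1 and 2 resonate with the product of the first component of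
  \<open>v0\<close> and the initial acceleration, so that the derivative at time 0 of the tested
  quantity is nonzero.\<close>

definition \<Psi> :: "real^3 \<Rightarrow> real" where
  "\<Psi> x = sin (x$1) * sin (2 * x$2) * \<psi> (x$3)"

definition grad_\<Psi> :: "real^3 \<Rightarrow> real^3" where
  "grad_\<Psi> x = vector
     [cos (x$1) * sin (2 * x$2) * \<psi> (x$3),
      sin (x$1) * (2 * cos (2 * x$2)) * \<psi> (x$3),
      sin (x$1) * sin (2 * x$2) * \<psi>' (x$3)]"

definition hess_\<Psi> :: "real^3 \<Rightarrow> real^3^3" where
  "hess_\<Psi> x = vector
     [vector [- sin (x$1) * sin (2 * x$2) * \<psi> (x$3),
              cos (x$1) * (2 * cos (2 * x$2)) * \<psi> (x$3),
              cos (x$1) * sin (2 * x$2) * \<psi>' (x$3)],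
      vector [cos (x$1) * (2 * cos (2 * x$2)) * \<psi> (x$3),
              sin (x$1) * (- 4 * sin (2 * x$2)) * \<psi> (x$3),
              sin (x$1) * (2 * cos (2 * x$2)) * \<psi>' (x$3)],
      vector [cos (x$1) * sin (2 * x$2) * \<psi>' (x$3),
              sin (x$1) * (2 * cos (2 * x$2)) * \<psi>' (x$3),
              sin (x$1) * sin (2 * x$2) * (5 * \<psi> (x$3))]]"

lemma C1_grad_\<Psi>: "C1_grad \<Psi> grad_\<Psi>"
  unfolding \<Psi>_def[abs_def] grad_\<Psi>_def[abs_def]
  by (rule C1_grad_separated)
     (auto intro!: derivative_eq_intros continuous_intros DERIV_\<psi> continuous_\<psi>)

lemma C1_grad_grad_\<Psi>: "C1_grad (\<lambda>x. grad_\<Psi> x $ i) (\<lambda>x. hess_\<Psi> x $ i)"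
proof -
  have "C1_grad (\<lambda>x. grad_\<Psi> x $ 1) (\<lambda>x. hess_\<Psi> x $ 1)"
    unfolding grad_\<Psi>_def hess_\<Psi>_def vector_3
    by (rule C1_grad_separated)
       (auto intro!: derivative_eq_intros continuous_intros DERIV_\<psi> continuous_\<psi>)
  moreover have "C1_grad (\<lambda>x. grad_\<Psi> x $ 2) (\<lambda>x. hess_\<Psi> x $ 2)"
    unfolding grad_\<Psi>_def hess_\<Psi>_def vector_3
    by (rule C1_grad_separated)
       (auto intro!: derivative_eq_intros continuous_intros DERIV_\<psi> continuous_\<psi>)
  moreover have "C1_grad (\<lambda>x. grad_\<Psi> x $ 3) (\<lambda>x. hess_\<Psi> x $ 3)"
    unfolding grad_\<Psi>_def hess_\<Psi>_def vector_3
    by (rule C1_grad_separated)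
       (auto intro!: derivative_eq_intros continuous_intros DERIV_\<psi>' continuous_\<psi>)
  ultimately show ?thesis using exhaust_3[of i] by auto
qed

lemma hess_\<Psi>_symmetric: "hess_\<Psi> x $ i $ j = hess_\<Psi> x $ j $ i"
  using exhaust_3[of i] exhaust_3[of j] by (auto simp: hess_\<Psi>_def)

text \<open>Merges the two product-rule terms when the quadratic form is differentiated in
  time.\<close>

lemma hess_\<Psi>_self_adjoint: "u \<bullet> (hess_\<Psi> x *v w) = w \<bullet> (hess_\<Psi> x *v u)"
proof -
  have "transpose (hess_\<Psi> x) = hess_\<Psi> x"
    using hess_\<Psi>_symmetric by (simp add: transpose_def vec_eq_iff)
  then show ?thesis
    using dot_lmul_matrix[of u "hess_\<Psi> x" w] transpose_matrix_vector[of "hess_\<Psi> x" u]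
    by (simp add: inner_commute)
qed

lemma continuous_on_hess_\<Psi>: "continuous_on slab hess_\<Psi>"
proof -
  have "continuous_on slab (\<lambda>x. \<chi> i. hess_\<Psi> x $ i)"
    by (intro continuous_on_vec_lambda C1_gradD(2)[OF C1_grad_grad_\<Psi>])
  then show ?thesis by simp
qed

text \<open>Harmonicity: -1 - 4 + 5 = 0.\<close>

lemma trace_hess_\<Psi>: "(\<Sum>i\<in>UNIV. hess_\<Psi> x $ i $ i) = 0"
  by (simp add: sum_3 hess_\<Psi>_def)

text \<open>Removes the top face from the pressure integral, since matching says nothing about the
  pressure there.\<close>

lemma grad_\<Psi>_top: "x$3 = 2 \<Longrightarrow> grad_\<Psi> x $ 3 = 0"
  by (simp add: grad_\<Psi>_def \<psi>'_def)

lemma periodic_\<Psi>: "torus_periodic_on slab \<Psi>" "torus_periodic_on slab grad_\<Psi>"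
  by (simp_all add: torus_periodic_on_def \<Psi>_def grad_\<Psi>_def axis_def distrib_left sin_add cos_add)

lemma periodic_q0: "torus_periodic_on slab q0"
  by (simp add: torus_periodic_on_def q0_def axis_def)

text \<open>\<open>v0_t\<close> is \<open>- v0\<cdot>\<nabla>v0 - \<nabla>q0\<close>, simplified.\<close>

definition v0_t :: "real^3 \<Rightarrow> real^3" where
  "v0_t x = vector
     [sin (x$1) * cos (x$2) * (- (pi\<^sup>2 / 2) * cos (pi * (x$3 - 1))),
      cos (x$1) * sin (x$2) * (- (pi\<^sup>2 / 2) * cos (pi * (x$3 - 1))),
      cos (x$1) * cos (x$2) * (pi * sin (pi * (x$3 - 1)))]"

text \<open>The diagonal derivatives of \<open>v0_t\<close> carry the coefficients
  \<open>- (pi\<^sup>2 / 2)\<close>, \<open>- (pi\<^sup>2 / 2)\<close> and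
  \<open>pi\<^sup>2\<close>, which cancel, and its vertical component has the factor
  \<open>sin (pi * (x$3 - 1))\<close>, which is zero on both faces.\<close>

lemma cell_integral_v0_t_solenoidal:
  assumes "C1_grad \<phi> d" "torus_periodic_on slab \<phi>"
  shows "cell_integral (\<lambda>x. v0_t x \<bullet> d x) = 0"
proof -
  have 1: "C1_grad (\<lambda>x. v0_t x $ 1) (\<lambda>x. vector
     [cos (x$1) * cos (x$2) * (- (pi\<^sup>2 / 2) * cos (pi * (x$3 - 1))),
      sin (x$1) * - sin (x$2) * (- (pi\<^sup>2 / 2) * cos (pi * (x$3 - 1))),
      sin (x$1) * cos (x$2) * (pi\<^sup>2 / 2 * pi * sin (pi * (x$3 - 1)))])"
    (is "C1_grad _ ?g1")
    unfolding v0_t_def vector_3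
    by (rule C1_grad_separated) (auto intro!: derivative_eq_intros continuous_intros)
  have 2: "C1_grad (\<lambda>x. v0_t x $ 2) (\<lambda>x. vector
     [- sin (x$1) * sin (x$2) * (- (pi\<^sup>2 / 2) * cos (pi * (x$3 - 1))),
      cos (x$1) * cos (x$2) * (- (pi\<^sup>2 / 2) * cos (pi * (x$3 - 1))),
      cos (x$1) * sin (x$2) * (pi\<^sup>2 / 2 * pi * sin (pi * (x$3 - 1)))])"
    (is "C1_grad _ ?g2")
    unfolding v0_t_def vector_3
    by (rule C1_grad_separated) (auto intro!: derivative_eq_intros continuous_intros)
  have 3: "C1_grad (\<lambda>x. v0_t x $ 3) (\<lambda>x. vector
     [- sin (x$1) * cos (x$2) * (pi * sin (pi * (x$3 - 1))),
      cos (x$1) * - sin (x$2) * (pi * sin (pi * (x$3 - 1))),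
      cos (x$1) * cos (x$2) * (pi\<^sup>2 * cos (pi * (x$3 - 1)))])"
    (is "C1_grad _ ?g3")
    unfolding v0_t_def vector_3
    by (rule C1_grad_separated) (auto intro!: derivative_eq_intros continuous_intros simp: power2_eq_square)
  define g where "g = (\<lambda>i::3. if i = 1 then ?g1 else if i = 2 then ?g2 else ?g3)"
  show ?thesis
  proof (rule cell_integral_solenoidal[OF _ _ _ _ assms])
    show "C1_grad (\<lambda>x. v0_t x $ i) (g i)" for i
      using exhaust_3[of i] 1 2 3 by (auto simp: g_def)
    show "torus_periodic_on slab v0_t"
      by (simp add: torus_periodic_on_def v0_t_def axis_def)
    show "(\<Sum>i\<in>UNIV. g i x $ i) = 0" for x
      by (simp add: sum_3 g_def)
    show "v0_t x $ 3 = 0" if "x \<in> frontier Omega1" for x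
      using that by (auto simp: frontier_Omega1 v0_t_def)
  qed
qed

section \<open>Explicit integrals and the sign of the initial derivative\<close>

lemma integral_by_antiderivative:
  fixes F f :: "real \<Rightarrow> real"
  assumes "a \<le> b" "\<And>x. (F has_real_derivative f x) (at x)"
  shows "integral {a..b} f = F b - F a"
  using assms
  by (intro integral_unique fundamental_theorem_of_calculus)
     (auto simp: has_real_derivative_iff_has_vector_derivative intro: has_vector_derivative_at_within)

lemma trig_integrals:
  "integral {0..2 * pi} (\<lambda>s. (sin s)\<^sup>2) = pi"
  "integral {0..2 * pi} (\<lambda>s. (cos s)\<^sup>2) = pi"
  "integral {0..2 * pi} (\<lambda>s. (sin s)\<^sup>2 * cos s) = 0"
  "integral {0..2 * pi} (\<lambda>s. sin s * cos s * sin (2 * s)) = pi / 2"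
  "integral {0..2 * pi} (\<lambda>s. (sin s)\<^sup>2 * cos (2 * s)) = - pi / 2"
proof -
  have [simp]: "sin (pi * 4) = 0" "cos (pi * 4) = 1"
    using sin_2npi[of 2] cos_2npi[of 2] by (simp_all add: mult.commute)
  have "((\<lambda>s. (s - sin s * cos s) / 2) has_real_derivative (sin s)\<^sup>2) (at s)" for s
    by (auto intro!: derivative_eq_intros simp: cos_squared_eq power2_eq_square[symmetric])
  from integral_by_antiderivative[OF _ this, of 0 "2 * pi"]
  show "integral {0..2 * pi} (\<lambda>s. (sin s)\<^sup>2) = pi" by simp
  have "((\<lambda>s. (s + sin s * cos s) / 2) has_real_derivative (cos s)\<^sup>2) (at s)" for s
    by (auto intro!: derivative_eq_intros simp: sin_squared_eq power2_eq_square[symmetric])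
  from integral_by_antiderivative[OF _ this, of 0 "2 * pi"]
  show "integral {0..2 * pi} (\<lambda>s. (cos s)\<^sup>2) = pi" by simp
  have "((\<lambda>s. (sin s)^3 / 3) has_real_derivative (sin s)\<^sup>2 * cos s) (at s)" for s
    by (auto intro!: derivative_eq_intros)
  from integral_by_antiderivative[OF _ this, of 0 "2 * pi"]
  show "integral {0..2 * pi} (\<lambda>s. (sin s)\<^sup>2 * cos s) = 0" by simp
  \<comment> \<open>By double angles the integrand is half the square of sin 2s, that is (1 - cos
    4s) / 4.\<close>
  have "((\<lambda>s. s / 4 - sin (4 * s) / 16) has_real_derivative sin s * cos s * sin (2 * s)) (at s)" for s
  proof -
    have "cos (4 * s) = 1 - 2 * (sin (2 * s))\<^sup>2"
      using cos_double_sin[of "2 * s"] by simp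
    moreover have "sin s * cos s * sin (2 * s) = (sin (2 * s))\<^sup>2 / 2"
      by (simp add: sin_double power2_eq_square)
    ultimately show ?thesis
      by (auto intro!: derivative_eq_intros simp: diff_divide_distrib)
  qed
  from integral_by_antiderivative[OF _ this, of 0 "2 * pi"]
  show "integral {0..2 * pi} (\<lambda>s. sin s * cos s * sin (2 * s)) = pi / 2"
    using sin_2npi[of 4] by (simp add: mult_ac)
  have "((\<lambda>s. sin (2 * s) / 4 - s / 4 - sin (4 * s) / 16) has_real_derivative (sin s)\<^sup>2 * cos (2 * s)) (at s)" for s
  proof -
    have "(sin s)\<^sup>2 * cos (2 * s) = cos (2 * s) / 2 - 1 / 4 - cos (4 * s) / 4"
    proof -
      have *: "(sin s)\<^sup>2 = (1 - cos (2 * s)) / 2" "cos (4 * s) = 2 * (cos (2 * s))\<^sup>2 - 1"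
        using cos_double_sin[of s] cos_double_cos[of "2 * s"] by simp_all
      show ?thesis
        unfolding * by (simp add: power2_eq_square field_simps)
    qed
    then show ?thesis
      by (auto intro!: derivative_eq_intros)
  qed
  from integral_by_antiderivative[OF _ this, of 0 "2 * pi"]
  show "integral {0..2 * pi} (\<lambda>s. (sin s)\<^sup>2 * cos (2 * s)) = - pi / 2"
    using sin_2npi[of 4] by (simp add: mult_ac)
qed

text \<open>Integrating by parts twice reproduces the integral with factor
  \<open>- (pi\<^sup>2) / 5\<close>, whence the denominator \<open>pi\<^sup>2 + 5\<close>. Only the
  endpoint 1 contributes, since \<open>\<psi>' 2 = 0\<close> and the sine is zero at both ends. The
  value is visibly positive.\<close>

lemma integral_cos_\<psi>:
  "integral {1..2} (\<lambda>s. cos (pi * (s - 1)) * \<psi> s) = sqrt 5 * sinh (sqrt 5) / (pi\<^sup>2 + 5)"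
proof -
  have "((\<lambda>s. (cos (pi * (s - 1)) * \<psi>' s + pi * sin (pi * (s - 1)) * \<psi> s) / (pi\<^sup>2 + 5))
      has_real_derivative cos (pi * (s - 1)) * \<psi> s) (at s)" for s
  proof -
    have "pi\<^sup>2 + 5 \<noteq> 0" by (smt (verit) zero_le_power2)
    then show ?thesis
      by (auto intro!: derivative_eq_intros DERIV_\<psi> DERIV_\<psi>' simp: divide_simps)
         (simp add: algebra_simps power2_eq_square)
  qed
  from integral_by_antiderivative[OF _ this, of 1 2] show ?thesis
    by (simp add: \<psi>'_def)
qed

lemma integral_sin_\<psi>':
  "integral {1..2} (\<lambda>s. pi * sin (pi * (s - 1)) * \<psi>' s) =
    - (pi\<^sup>2) * integral {1..2} (\<lambda>s. cos (pi * (s - 1)) * \<psi> s)"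
proof -
  have "((\<lambda>s. pi * sin (pi * (s - 1)) * \<psi> s) has_real_derivative
      pi * sin (pi * (s - 1)) * \<psi>' s + pi\<^sup>2 * (cos (pi * (s - 1)) * \<psi> s)) (at s)" for s
    by (auto intro!: derivative_eq_intros DERIV_\<psi> simp: power2_eq_square algebra_simps)
  from integral_by_antiderivative[OF _ this, of 1 2]
  have "integral {1..2} (\<lambda>s. pi * sin (pi * (s - 1)) * \<psi>' s + pi\<^sup>2 * (cos (pi * (s - 1)) * \<psi> s)) = 0"
    by simp
  also have "integral {1..2} (\<lambda>s. pi * sin (pi * (s - 1)) * \<psi>' s + pi\<^sup>2 * (cos (pi * (s - 1)) * \<psi> s)) =
     integral {1..2} (\<lambda>s. pi * sin (pi * (s - 1)) * \<psi>' s) + pi\<^sup>2 * integral {1..2} (\<lambda>s. cos (pi * (s - 1)) * \<psi> s)"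
    by (subst integral_add)
       (auto intro!: integrable_continuous_interval continuous_intros continuous_on_subset[OF continuous_\<psi>(1)]
          continuous_on_subset[OF continuous_\<psi>(2)])
  finally show ?thesis by simp
qed

text \<open>Expanding the bilinear form gives separated products, and all vertical integrals that
  survive are multiples of the positive number \<open>I\<close>.\<close>

lemma cell_integral_v0_hess_v0_t: "0 < cell_integral (\<lambda>x. v0 x \<bullet> (hess_\<Psi> x *v v0_t x))"
proof -
  define A where "A = (\<lambda>s. (pi\<^sup>2 + 2) / 2 * cos (pi * (s - 1)) - 1)"
  define D where "D = (\<lambda>s. - (pi\<^sup>2 / 2) * cos (pi * (s - 1)))"
  define E where "E = (\<lambda>s. pi * sin (pi * (s - 1)))"
  define I where "I = integral {1..2} (\<lambda>s. cos (pi * (s - 1)) * \<psi> s)"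
  define P where "P = (\<lambda>f g h :: real \<Rightarrow> real. \<lambda>x :: real^3. f (x$1) * g (x$2) * h (x$3))"
  \<comment> \<open>\<open>e1\<close>, \<open>e2\<close>, \<open>e3\<close> stem from the first
    component of \<open>v0\<close> and the first row of the Hessian; \<open>e4\<close>,
    \<open>e5\<close>, \<open>e6\<close> from the second component and row. The latter share the
    x1-factor \<open>(sin s)\<^sup>2 * cos s\<close>, whose mean over a period is zero.\<close>
  define e1 where "e1 = P (\<lambda>s. (sin s)\<^sup>2) (\<lambda>s. sin s * cos s * sin (2 * s)) (\<lambda>s. D s * \<psi> s)"
  define e2 where "e2 = P (\<lambda>s. (cos s)\<^sup>2) (\<lambda>s. (sin s)\<^sup>2 * cos (2 * s)) (\<lambda>s. D s * \<psi> s)"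
  define e3 where "e3 = P (\<lambda>s. (cos s)\<^sup>2) (\<lambda>s. sin s * cos s * sin (2 * s)) (\<lambda>s. E s * \<psi>' s)"
  define e4 where "e4 = P (\<lambda>s. (sin s)\<^sup>2 * cos s) (\<lambda>s. 2 * cos s * cos (2 * s)) (\<lambda>s. A s * D s * \<psi> s)"
  define e5 where "e5 = P (\<lambda>s. (sin s)\<^sup>2 * cos s) (\<lambda>s. 4 * sin s * sin (2 * s)) (\<lambda>s. A s * D s * \<psi> s)"
  define e6 where "e6 = P (\<lambda>s. (sin s)\<^sup>2 * cos s) (\<lambda>s. 2 * cos s * cos (2 * s)) (\<lambda>s. A s * E s * \<psi>' s)"
  have v0_eq: "v0 x = vector [sin (x$2), A (x$3) * sin (x$1), 0]" for x
    by (simp add: v0_def A_def)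
  have v0_t_eq: "v0_t x = vector
      [sin (x$1) * cos (x$2) * D (x$3), cos (x$1) * sin (x$2) * D (x$3), cos (x$1) * cos (x$2) * E (x$3)]" for x
    by (simp add: v0_t_def D_def E_def)
  have c: "continuous_on UNIV A" "continuous_on UNIV D" "continuous_on UNIV E"
    unfolding A_def D_def E_def by (auto intro!: continuous_intros)
  have P_int: "cell_integral (P f g h) = integral {0..2 * pi} f * integral {0..2 * pi} g * integral {1..2} h"
    if "continuous_on UNIV f" "continuous_on UNIV g" "continuous_on UNIV h" for f g h
    unfolding P_def using that by (rule cell_integral_separated)
  have P_cont: "continuous_on slab (P f g h)"
    if "continuous_on UNIV f" "continuous_on UNIV g" "continuous_on UNIV h" for f g h
    unfolding P_def
    by (intro continuous_intros continuous_on_compose2[OF that(1)] continuous_on_compose2[OF that(2)]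
        continuous_on_compose2[OF that(3)]) auto
  have cont [continuous_intros]: "continuous_on slab e1" "continuous_on slab e2" "continuous_on slab e3"
    "continuous_on slab e4" "continuous_on slab e5" "continuous_on slab e6"
    unfolding e1_def e2_def e3_def e4_def e5_def e6_def
    by (intro P_cont continuous_intros c continuous_\<psi>)+
  have I_D: "integral {1..2} (\<lambda>s. D s * \<psi> s) = - (pi\<^sup>2 / 2) * I"
    unfolding D_def I_def by (simp add: mult.assoc)
  have I_E: "integral {1..2} (\<lambda>s. E s * \<psi>' s) = - (pi\<^sup>2) * I"
    unfolding E_def I_def by (rule integral_sin_\<psi>')
  have int: "cell_integral e1 = - (pi^4 / 4) * I" "cell_integral e2 = pi^4 / 4 * I"
    "cell_integral e3 = - (pi^4 / 2) * I" "cell_integral e4 = 0" "cell_integral e5 = 0" "cell_integral e6 = 0"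
    unfolding e1_def e2_def e3_def e4_def e5_def e6_def
    by (subst P_int; (intro continuous_intros c continuous_\<psi>)?;
        simp add: trig_integrals I_D I_E; simp add: power2_eq_square power4_eq_xxxx)+
  have "cell_integral (\<lambda>x. v0 x \<bullet> (hess_\<Psi> x *v v0_t x)) =
      cell_integral (\<lambda>x. 2 * e2 x + e3 x - e1 x + e4 x - e5 x + e6 x)"
    by (rule cell_integral_cong_slab)
       (simp add: inner_vec_def matrix_vector_mult_def sum_3 v0_eq hess_\<Psi>_def v0_t_eq
          e1_def e2_def e3_def e4_def e5_def e6_def P_def power2_eq_square algebra_simps)
  also have "\<dots> = 2 * cell_integral e2 + cell_integral e3 - cell_integral e1
      + cell_integral e4 - cell_integral e5 + cell_integral e6"
    by (simp add: cell_integral_add cell_integral_diff cell_integral_cmult continuous_intros)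
  \<comment> \<open>In units of \<open>pi^4 * I\<close> the sum is 2/4 - 1/2 + 1/4.\<close>
  also have "\<dots> = pi^4 / 4 * I"
    by (simp add: int)
  also have "0 < \<dots>"
    unfolding I_def integral_cos_\<psi>
    by (intro mult_pos_pos divide_pos_pos) (auto simp: add_nonneg_pos)
  finally show ?thesis .
qed

section \<open>Evolution of the stress integral\<close>

text \<open>An Euler flow with its derivatives as named functions and with both equations valid up
  to the boundary. \<open>Dv t j\<close> is the spatial gradient of the velocity component with
  index \<open>j\<close>, and \<open>v'\<close> is the time derivative.\<close>

locale C1_euler_flow =
  fixes T :: real
    and v v' :: "real \<Rightarrow> real^3 \<Rightarrow> real^3" and Dv :: "real \<Rightarrow> 3 \<Rightarrow> real^3 \<Rightarrow> real^3"
    and q :: "real \<Rightarrow> real^3 \<Rightarrow> real" and Dq :: "real \<Rightarrow> real^3 \<Rightarrow> real^3"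
  assumes T_pos: "0 < T"
    and v_C1: "t \<in> {0..T} \<Longrightarrow> C1_grad (\<lambda>x. v t x $ i) (Dv t i)"
    and q_C1: "t \<in> {0..T} \<Longrightarrow> C1_grad (q t) (Dq t)"
    and v_time: "t \<in> {0..T} \<Longrightarrow> x \<in> slab \<Longrightarrow>
      ((\<lambda>s. v s x) has_vector_derivative v' t x) (at t within {0..T})"
    and v_continuous: "continuous_on ({0..T} \<times> slab) (\<lambda>(t, x). v t x)"
    and v'_continuous: "continuous_on ({0..T} \<times> slab) (\<lambda>(t, x). v' t x)"
    and v_periodic: "t \<in> {0..T} \<Longrightarrow> torus_periodic_on slab (v t)"
    and q_periodic: "t \<in> {0..T} \<Longrightarrow> torus_periodic_on slab (q t)"
    and momentum: "t \<in> {0..T} \<Longrightarrow> x \<in> slab \<Longrightarrow> v' t x $ j + v t x \<bullet> Dv t j x + Dq t x $ j = 0"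
    and incompressible: "t \<in> {0..T} \<Longrightarrow> x \<in> slab \<Longrightarrow> (\<Sum>i\<in>UNIV. Dv t i x $ i) = 0"
    and impermeable: "t \<in> {0..T} \<Longrightarrow> x \<in> frontier Omega1 \<Longrightarrow> v t x $ 3 = 0"
begin

lemma slice_continuous:
  assumes "t \<in> {0..T}"
  shows "continuous_on slab (v t)" "continuous_on slab (v' t)"
    "continuous_on slab (Dv t i)" "continuous_on slab (Dq t)" "continuous_on slab (q t)"
proof -
  have "continuous_on slab (\<lambda>x. (t, x))" "(\<lambda>x. (t, x)) ` slab \<subseteq> {0..T} \<times> slab"
    using assms by (auto intro!: continuous_intros)
  then show "continuous_on slab (v t)" "continuous_on slab (v' t)"
    using continuous_on_compose2[OF v_continuous, of slab "\<lambda>x. (t, x)"]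
      continuous_on_compose2[OF v'_continuous, of slab "\<lambda>x. (t, x)"] by simp_all
  show "continuous_on slab (Dv t i)" "continuous_on slab (Dq t)" "continuous_on slab (q t)"
    using v_C1[OF assms] q_C1[OF assms] by (auto dest: C1_gradD)
qed

text \<open>Leibniz' rule on the compact cell, one-sided at the ends of the time interval.\<close>

lemma has_derivative_cell_integral:
  assumes f: "\<And>t x. t \<in> {0..T} \<Longrightarrow> x \<in> slab \<Longrightarrow>
      ((\<lambda>t. f t x) has_real_derivative f' t x) (at t within {0..T})"
    and "\<And>t. t \<in> {0..T} \<Longrightarrow> continuous_on slab (f t)"
    and "continuous_on ({0..T} \<times> slab) (\<lambda>(t, x). f' t x)" and "t \<in> {0..T}"
  shows "((\<lambda>t. cell_integral (f t)) has_real_derivative cell_integral (f' t)) (at t within {0..T})"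
proof -
  have "continuous_on ({0..T} \<times> cell) (\<lambda>(t, p). f' t (pt p))"
    using continuous_on_compose2[OF assms(3), of "{0..T} \<times> cell" "\<lambda>(t, p). (t, pt p)"] pt_in_slab
    by (force intro!: continuous_intros continuous_on_compose2[OF continuous_on_pt[of UNIV]]
        simp: case_prod_beta')
  then have "((\<lambda>t. integral cell (\<lambda>p. f t (pt p))) has_vector_derivative integral cell (\<lambda>p. f' t (pt p)))
      (at t within {0..T})"
    using f assms(2,4) pt_in_slab
    by (intro leibniz_rule_vector_derivative)
       (auto simp: pt_integrable has_real_derivative_iff_has_vector_derivative image_subset_iff)
  then show ?thesis
    by (simp add: cell_integral_def has_real_derivative_iff_has_vector_derivative)
qed

text \<open>The velocity is orthogonal to the fixed gradient \<open>d\<close> at every time, so the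
  time derivative of that vanishing integral is zero. This route involves no mixed second
  derivatives of the velocity.\<close>

lemma cell_integral_acceleration:
  assumes "C1_grad \<phi> d" "torus_periodic_on slab \<phi>" "t \<in> {0..T}"
  shows "cell_integral (\<lambda>x. v' t x \<bullet> d x) = 0"
proof -
  have d: "continuous_on slab d" using assms(1) by (rule C1_gradD)
  have "((\<lambda>t. cell_integral (\<lambda>x. v t x \<bullet> d x)) has_real_derivative cell_integral (\<lambda>x. v' t x \<bullet> d x))
      (at t within {0..T})"
  proof (rule has_derivative_cell_integral[OF _ _ _ assms(3)])
    show "((\<lambda>t. v t x \<bullet> d x) has_real_derivative v' t x \<bullet> d x) (at t within {0..T})"
      if "t \<in> {0..T}" "x \<in> slab" for t x
      using v_time[OF that]
      by (auto simp: has_real_derivative_iff_has_vector_derivative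
          intro: bounded_linear.has_vector_derivative[OF bounded_linear_inner_left])
    show "continuous_on slab (\<lambda>x. v t x \<bullet> d x)" if "t \<in> {0..T}" for t
      using slice_continuous(1)[OF that] d by (intro continuous_intros)
    show "continuous_on ({0..T} \<times> slab) (\<lambda>(t, x). v' t x \<bullet> d x)"
      using v'_continuous
      by (auto intro!: continuous_intros continuous_on_compose2[OF d] simp: case_prod_beta)
  qed
  moreover have "((\<lambda>t. cell_integral (\<lambda>x. v t x \<bullet> d x)) has_real_derivative 0) (at t within {0..T})"
  proof (rule has_field_derivative_transform_within[OF DERIV_const zero_less_one assms(3)])
    show "0 = cell_integral (\<lambda>x. v s x \<bullet> d x)" if "s \<in> {0..T}" for s
      by (rule cell_integral_solenoidal[OF v_C1 v_periodic incompressible impermeable assms(1,2), symmetric])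
         (use that in auto)
  qed
  moreover have "at t within {0..T} \<noteq> bot"
    using assms(3) T_pos by (simp add: trivial_limit_within islimpt_Icc)
  ultimately show ?thesis
    using has_real_derivative_iff_has_vector_derivative vector_derivative_unique_within by blast
qed

text \<open>The gradient of the scalar product of \<open>v t\<close> with
  \<open>grad_\<Psi>\<close>, contracted with \<open>v t\<close>, integrates to zero and equals the
  Hessian form plus advection tested with \<open>grad_\<Psi>\<close>. The momentum equation then
  trades advection for the pressure gradient, as the acceleration drops out.\<close>

lemma cell_integral_stress:
  assumes "t \<in> {0..T}"
  shows "cell_integral (\<lambda>x. v t x \<bullet> (hess_\<Psi> x *v v t x)) = cell_integral (\<lambda>x. Dq t x \<bullet> grad_\<Psi> x)"
proof -
  \<comment> \<open>The product rule for the gradient of the scalar product of \<open>v t\<close>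
    and \<open>grad_\<Psi>\<close>.\<close>
  define d where "d x = (\<Sum>j\<in>UNIV. (v t x $ j) *\<^sub>R hess_\<Psi> x $ j + (grad_\<Psi> x $ j) *\<^sub>R Dv t j x)" for x
  define adv :: "real^3 \<Rightarrow> real^3" where "adv x = (\<chi> j. v t x \<bullet> Dv t j x)" for x
  note c = slice_continuous[OF assms] C1_gradD(2)[OF C1_grad_\<Psi>] continuous_on_hess_\<Psi>
  have adv_c: "continuous_on slab adv"
    unfolding adv_def by (intro continuous_intros c)
  have "C1_grad (\<lambda>x. \<Sum>j\<in>UNIV. v t x $ j * grad_\<Psi> x $ j) d"
    unfolding d_def by (intro C1_grad_sum C1_grad_mult v_C1[OF assms] C1_grad_grad_\<Psi>) simp
  moreover have "torus_periodic_on slab (\<lambda>x. \<Sum>j\<in>UNIV. v t x $ j * grad_\<Psi> x $ j)"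
    using v_periodic[OF assms] periodic_\<Psi>(2) by (simp add: torus_periodic_on_def)
  ultimately have "cell_integral (\<lambda>x. v t x \<bullet> d x) = 0"
    using v_C1[OF assms] v_periodic[OF assms] incompressible[OF assms] impermeable[OF assms]
    by (rule cell_integral_solenoidal[rotated 4])
  moreover have "v t x \<bullet> d x = v t x \<bullet> (hess_\<Psi> x *v v t x) + adv x \<bullet> grad_\<Psi> x" for x
  proof -
    have "v t x \<bullet> d x = (\<Sum>j\<in>UNIV. v t x $ j * (v t x \<bullet> hess_\<Psi> x $ j)) + adv x \<bullet> grad_\<Psi> x"
      by (simp add: d_def adv_def inner_sum_right inner_add_right sum.distrib inner_vec_def[of "vec_lambda _"] mult.commute)
    also have "(\<Sum>j\<in>UNIV. v t x $ j * (v t x \<bullet> hess_\<Psi> x $ j)) = v t x \<bullet> (hess_\<Psi> x *v v t x)"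
      by (simp add: inner_vec_def[of "v t x" "_ *v _"] matrix_vector_mul_component inner_commute)
    finally show ?thesis .
  qed
  ultimately have "cell_integral (\<lambda>x. v t x \<bullet> (hess_\<Psi> x *v v t x)) + cell_integral (\<lambda>x. adv x \<bullet> grad_\<Psi> x) = 0"
    by (subst cell_integral_add[symmetric])
       (auto intro!: continuous_intros c adv_c simp: matrix_vector_mult_def)
  moreover have "cell_integral (\<lambda>x. v' t x \<bullet> grad_\<Psi> x) = 0"
    by (rule cell_integral_acceleration[OF C1_grad_\<Psi> periodic_\<Psi>(1) assms])
  moreover have "cell_integral (\<lambda>x. v' t x \<bullet> grad_\<Psi> x) =
      cell_integral (\<lambda>x. 0 - adv x \<bullet> grad_\<Psi> x - Dq t x \<bullet> grad_\<Psi> x)"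
  proof (rule cell_integral_cong_slab)
    fix x assume "x \<in> slab"
    then have "v' t x + adv x + Dq t x = 0"
      using momentum[OF assms, of x] by (simp add: vec_eq_iff adv_def)
    then have "(v' t x + adv x + Dq t x) \<bullet> grad_\<Psi> x = 0" by simp
    then show "v' t x \<bullet> grad_\<Psi> x = 0 - adv x \<bullet> grad_\<Psi> x - Dq t x \<bullet> grad_\<Psi> x"
      by (simp add: inner_add_left)
  qed
  moreover have "\<dots> = cell_integral (\<lambda>x. 0) - cell_integral (\<lambda>x. adv x \<bullet> grad_\<Psi> x)
      - cell_integral (\<lambda>x. Dq t x \<bullet> grad_\<Psi> x)"
    by (simp only: cell_integral_diff continuous_intros c adv_c)
  moreover have "cell_integral (\<lambda>x. 0) = 0"
    by (simp add: cell_integral_def)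
  ultimately show ?thesis by linarith
qed

text \<open>Integrate the pressure term by parts: \<open>grad_\<Psi>\<close> is divergence free and
  tangential at the top, so only the interface remains, where \<open>q t\<close> is the constant
  \<open>- c\<close>.\<close>

lemma cell_integral_stress_eq_0:
  assumes "t \<in> {0..T}" "\<And>x. x \<in> interface \<Longrightarrow> q t x + c = 0"
  shows "cell_integral (\<lambda>x. v t x \<bullet> (hess_\<Psi> x *v v t x)) = 0"
proof -
  have q: "q t (pt (a, b, 1)) = - c" for a b
    using assms(2)[of "pt (a, b, 1)"] by (simp add: interface_def)
  \<comment> \<open>The vertical derivative of \<open>\<Psi>\<close> has horizontal mean zero, so
    any additive constant in the pressure is harmless.\<close>
  have "integral {0..2 * pi} sin = 0"
    using integral_by_antiderivative[of 0 "2 * pi" "\<lambda>s. - cos s" sin]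
    by (auto intro!: derivative_eq_intros)
  then have faces: "integral {0..2 * pi} (\<lambda>a. integral {0..2 * pi} (\<lambda>b. c * grad_\<Psi> (pt (a, b, 1)) $ 3)) = 0"
    by (simp add: grad_\<Psi>_def mult_ac)
  have "cell_integral (\<lambda>x. Dq t x \<bullet> grad_\<Psi> x) =
      cell_integral (\<lambda>x. (\<Sum>i\<in>UNIV. hess_\<Psi> x $ i $ i) * q t x + grad_\<Psi> x \<bullet> Dq t x)"
    by (simp add: trace_hess_\<Psi> inner_commute)
  also have "\<dots> = 0"
    using cell_integral_weighted_divergence[OF C1_grad_grad_\<Psi> periodic_\<Psi>(2) q_C1 q_periodic, OF assms(1) assms(1)]
      faces by (simp add: q grad_\<Psi>_top)
  finally show ?thesis
    using cell_integral_stress[OF assms(1)] by simp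
qed

text \<open>Uniqueness of the Leray projection: the flow's own pressure at time 0 is not assumed to
  be \<open>q0\<close>, so the two gradients have to be compared. Equality is obtained on the cell,
  the domain of the integrals.\<close>

lemma initial_acceleration:
  assumes init: "\<And>x. x \<in> slab \<Longrightarrow> v 0 x = v0 x" and "p \<in> cell"
  shows "v' 0 (pt p) = v0_t (pt p)"
proof -
  have zero: "0 \<in> {0..T}" using T_pos by simp
  define d where "d x = grad_q0 x - Dq 0 x" for x
  have d: "C1_grad (\<lambda>x. q0 x - q 0 x) d"
    unfolding d_def by (intro C1_grad_diff C1_grad_q0 q_C1 zero)
  have periodic: "torus_periodic_on slab (\<lambda>x. q0 x - q 0 x)"
    using periodic_q0 q_periodic[OF zero] by (simp add: torus_periodic_on_def)
  have eq: "v' 0 x - v0_t x = d x" if x: "x \<in> slab" for x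
  proof -
    have v0_C1: "C1_grad (\<lambda>x. v0 x $ i) (Dv 0 i)" for i
      by (rule C1_grad_cong[OF v_C1[OF zero]]) (simp_all add: init)
    have Dv: "Dv 0 i x $ j = pd j (\<lambda>x. v0 x $ i) x" for i j
      by (rule C1_gradD(4)[OF v0_C1 x, symmetric])
    \<comment> \<open>\<open>v0_t\<close> satisfies the initial momentum balance with the pressure
      \<open>q0\<close>; subtracting it from the flow's balance cancels the advection.\<close>
    have "v0_t x $ j + v0 x \<bullet> Dv 0 j x + grad_q0 x $ j = 0" for j
      using exhaust_3[of j]
      by (elim disjE; simp add: inner_vec_def sum_3 Dv C1_grad_v0[THEN C1_gradD(4)] x;
          simp add: v0_def v0_t_def grad_q0_def field_simps)
    then have "(v' 0 x - v0_t x) $ j = d x $ j" for j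
      using momentum[OF zero x, of j] unfolding init[OF x] d_def vector_minus_component
      by (smt (verit))
    then show ?thesis by (simp add: vec_eq_iff)
  qed
  have c: "continuous_on slab d" "continuous_on slab (v' 0)"
    using d slice_continuous[OF zero] by (auto dest: C1_gradD)
  have "continuous_on slab (\<lambda>x. v' 0 x - d x)" using c by (intro continuous_intros)
  then have c': "continuous_on slab v0_t"
    by (rule continuous_on_eq) (use eq in \<open>auto simp: algebra_simps\<close>)
  \<comment> \<open>\<open>v' 0\<close> and \<open>v0_t\<close> are both orthogonal to gradients, and they differ by the gradient \<open>d\<close>.\<close>
  have "cell_integral (\<lambda>x. d x \<bullet> d x) = cell_integral (\<lambda>x. v' 0 x \<bullet> d x - v0_t x \<bullet> d x)"
    by (rule cell_integral_cong_slab) (simp add: eq flip: inner_diff_left)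
  also have "\<dots> = cell_integral (\<lambda>x. v' 0 x \<bullet> d x) - cell_integral (\<lambda>x. v0_t x \<bullet> d x)"
    by (intro cell_integral_diff continuous_intros c c')
  also have "\<dots> = 0"
    by (simp add: cell_integral_acceleration[OF d periodic zero] cell_integral_v0_t_solenoidal[OF d periodic])
  finally have "d (pt p) = 0"
    using cell_integral_sq_eq_0 c(1) assms(2) by blast
  moreover have "pt p \<in> slab" using pt_in_slab assms(2) by blast
  ultimately show ?thesis using eq by fastforce
qed

text \<open>Matching at time \<open>t\<close> forces \<open>G t = 0\<close>, whereas the right
  derivative of \<open>G\<close> at 0 is positive.\<close>

lemma not_matching:
  assumes init: "\<And>x. x \<in> slab \<Longrightarrow> v 0 x = v0 x"
  shows "\<exists>t0\<in>{0<..T}. \<forall>t\<in>{0<..<t0}. \<not> (\<exists>c. \<forall>x\<in>interface. q t x + c = 0)"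
proof -
  have zero: "0 \<in> {0..T}" using T_pos by simp
  define G where "G t = cell_integral (\<lambda>x. v t x \<bullet> (hess_\<Psi> x *v v t x))" for t
  note H = continuous_on_hess_\<Psi>
  have "(G has_real_derivative cell_integral (\<lambda>x. 2 * (v 0 x \<bullet> (hess_\<Psi> x *v v' 0 x)))) (at 0 within {0..T})"
    unfolding G_def
  proof (rule has_derivative_cell_integral[OF _ _ _ zero])
    show "((\<lambda>t. v t x \<bullet> (hess_\<Psi> x *v v t x)) has_real_derivative 2 * (v t x \<bullet> (hess_\<Psi> x *v v' t x)))
        (at t within {0..T})" if "t \<in> {0..T}" "x \<in> slab" for t x
    proof -
      have v: "((\<lambda>s. v s x) has_derivative (\<lambda>h. h *\<^sub>R v' t x)) (at t within {0..T})"
        using v_time[OF that] by (simp add: has_vector_derivative_def)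
      have "((\<lambda>t. v t x \<bullet> (hess_\<Psi> x *v v t x)) has_derivative
         (\<lambda>h. v t x \<bullet> (hess_\<Psi> x *v (h *\<^sub>R v' t x)) + (h *\<^sub>R v' t x) \<bullet> (hess_\<Psi> x *v v t x))) (at t within {0..T})"
        by (intro has_derivative_inner v bounded_linear.has_derivative[OF _ v] matrix_vector_mul_bounded_linear)
      then show ?thesis
        unfolding has_field_derivative_def
        by (rule has_derivative_eq_rhs)
           (auto simp: hess_\<Psi>_self_adjoint[of "v' t x"] matrix_vector_mult_scaleR algebra_simps)
    qed
    show "continuous_on slab (\<lambda>x. v t x \<bullet> (hess_\<Psi> x *v v t x))" if "t \<in> {0..T}" for t
      unfolding matrix_vector_mult_def by (intro continuous_intros slice_continuous[OF that] H)
    show "continuous_on ({0..T} \<times> slab) (\<lambda>(t, x). 2 * (v t x \<bullet> (hess_\<Psi> x *v v' t x)))"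
      using v_continuous v'_continuous unfolding matrix_vector_mult_def case_prod_beta
      by (intro continuous_intros continuous_on_compose2[OF H]) auto
  qed
  moreover have "cell_integral (\<lambda>x. 2 * (v 0 x \<bullet> (hess_\<Psi> x *v v' 0 x))) =
      2 * cell_integral (\<lambda>x. v0 x \<bullet> (hess_\<Psi> x *v v0_t x))"
    unfolding cell_integral_cmult[symmetric]
    by (rule cell_integral_cong) (use pt_in_slab init initial_acceleration[OF init] in \<open>simp add: image_subset_iff\<close>)
  ultimately obtain D where G: "(G has_real_derivative D) (at 0 within {0..T})" and D: "0 < D"
    using cell_integral_v0_hess_v0_t by simp
  have "\<forall>\<^sub>F t in at 0 within {0..T}. G t \<noteq> 0"
  \<comment> \<open>The split makes the value of \<open>G 0\<close> irrelevant: if it is nonzero,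
    continuity suffices; otherwise the difference quotient reduces to \<open>G t / t\<close> and has
    a nonzero limit.\<close>
  proof (cases "G 0 = 0")
    case False
    then show ?thesis
      using G DERIV_continuous continuous_within tendsto_imp_eventually_ne by blast
  next
    case True
    have "((\<lambda>t. (G t - G 0) / (t - 0)) \<longlongrightarrow> D) (at 0 within {0..T})"
      using G by (simp add: has_field_derivative_iff)
    then have "\<forall>\<^sub>F t in at 0 within {0..T}. (G t - G 0) / (t - 0) \<noteq> 0"
      using D by (intro tendsto_imp_eventually_ne) auto
    then show ?thesis
      by (rule eventually_mono) (use True in auto)
  qed
  then obtain e where e: "e > 0" "\<And>t. t \<in> {0..T} \<Longrightarrow> t \<noteq> 0 \<Longrightarrow> \<bar>t\<bar> < e \<Longrightarrow> G t \<noteq> 0"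
    by (auto simp: eventually_at dist_real_def)
  show ?thesis
  \<comment> \<open>The minimum keeps \<open>t\<close> both inside the interval where
    \<open>G\<close> has no zero and inside the lifespan.\<close>
  proof (intro bexI[of _ "min e T"] ballI notI)
    show "min e T \<in> {0<..T}" using e(1) T_pos by simp
    fix t assume "t \<in> {0<..<min e T}" and c: "\<exists>c. \<forall>x\<in>interface. q t x + c = 0"
    then have "t \<in> {0..T}" "G t \<noteq> 0" using e(2)[of t] by auto
    with c show False
      using cell_integral_stress_eq_0 by (auto simp: G_def)
  qed
qed

end

section \<open>From regular Euler solutions to the abstract flow\<close>

text \<open>The joint derivative in time and space, evaluated at \<open>(0, h)\<close> and
  \<open>(1, 0)\<close>, gives the derivatives of the spatial and temporal slices by the chain rule
  for the embeddings of the slices.\<close>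

lemma C_on_1_slices:
  fixes T :: real and f :: "real \<Rightarrow> real^3 \<Rightarrow> 'b::real_normed_vector"
  assumes "C_on 1 ({0..T} \<times> slab) (\<lambda>(t, x). f t x)"
  shows "\<exists>f' :: real \<times> (real^3) \<Rightarrow> real \<times> (real^3) \<Rightarrow> 'b.
    (\<forall>t\<in>{0..T}. \<forall>x\<in>slab. (f t has_derivative (\<lambda>h. f' (t, x) (0, h))) (at x within slab)) \<and>
    (\<forall>t\<in>{0..T}. \<forall>x\<in>slab. ((\<lambda>t. f t x) has_vector_derivative f' (t, x) (1, 0)) (at t within {0..T})) \<and>
    continuous_on ({0..T} \<times> slab) (\<lambda>(t, x). f t x) \<and>
    continuous_on ({0..T} \<times> slab) (\<lambda>p. f' p (1, 0)) \<and>
    (\<forall>t\<in>{0..T}. \<forall>i. continuous_on slab (\<lambda>x. f' (t, x) (0, axis i 1)))"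
proof -
  from assms obtain f' where
    f': "\<And>p. p \<in> {0..T} \<times> slab \<Longrightarrow> ((\<lambda>(t, x). f t x) has_derivative f' p) (at p within {0..T} \<times> slab)"
    and cont: "\<And>b. b \<in> Basis \<Longrightarrow> continuous_on ({0..T} \<times> slab) (\<lambda>p. f' p b)"
    by auto
  show ?thesis
  proof (intro exI[of _ f'] conjI ballI allI)
    fix t x assume *: "t \<in> {0..T}" "x \<in> slab"
    show "(f t has_derivative (\<lambda>h. f' (t, x) (0, h))) (at x within slab)"
    proof (rule has_derivative_in_compose[where f = "\<lambda>x. (t, x)" and g = "\<lambda>(t, x). f t x", simplified])
      show "((\<lambda>x. (t, x)) has_derivative (\<lambda>h. (0, h))) (at x within slab)"
        by (auto intro!: derivative_eq_intros)
      show "((\<lambda>(t, x). f t x) has_derivative f' (t, x)) (at (t, x) within (\<lambda>x. (t, x)) ` slab)"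
        by (rule has_derivative_subset[OF f']) (use * in auto)
    qed
    have "((\<lambda>t. f t x) has_derivative (\<lambda>h. f' (t, x) (h, 0))) (at t within {0..T})"
    proof (rule has_derivative_in_compose[where f = "\<lambda>t. (t, x)" and g = "\<lambda>(t, x). f t x", simplified])
      show "((\<lambda>t. (t, x)) has_derivative (\<lambda>h. (h, 0))) (at t within {0..T})"
        by (auto intro!: derivative_eq_intros)
      show "((\<lambda>(t, x). f t x) has_derivative f' (t, x)) (at (t, x) within (\<lambda>t. (t, x)) ` {0..T})"
        by (rule has_derivative_subset[OF f']) (use * in auto)
    qed
    moreover have "(\<lambda>h. f' (t, x) (h, 0)) = (\<lambda>h. h *\<^sub>R f' (t, x) (1, 0))"
    proof
      fix h
      have "linear (f' (t, x))"
        by (rule has_derivative_linear[OF f']) (use * in simp)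
      from linear_cmul[OF this, of h "(1, 0)"]
      show "f' (t, x) (h, 0) = h *\<^sub>R f' (t, x) (1, 0)" by simp
    qed
    ultimately show "((\<lambda>t. f t x) has_vector_derivative f' (t, x) (1, 0)) (at t within {0..T})"
      unfolding has_vector_derivative_def by (rule has_derivative_eq_rhs)
  next
    show "continuous_on ({0..T} \<times> slab) (\<lambda>(t, x). f t x)"
      using f' by (rule has_derivative_continuous_on)
    show "continuous_on ({0..T} \<times> slab) (\<lambda>p. f' p (1, 0))"
      by (rule cont) (simp add: Basis_prod_def)
    show "continuous_on slab (\<lambda>x. f' (t, x) (0, axis i 1))" if "t \<in> {0..T}" for t i
      by (rule continuous_on_compose2[OF cont, of "(0, axis i 1)" slab "\<lambda>x. (t, x)"])
         (use that in \<open>auto intro!: continuous_intros simp: Basis_prod_def Basis_vec_def\<close>)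
  qed
qed

text \<open>A linear functional is the inner product with the vector of its values on the coordinate
  axes.\<close>

lemma C1_gradI:
  assumes "\<And>x. x \<in> slab \<Longrightarrow> (f has_derivative f' x) (at x within slab)"
    and "\<And>i. continuous_on slab (\<lambda>x. f' x (axis i 1))"
  shows "C1_grad f (\<lambda>x. \<chi> i. f' x (axis i 1))"
proof -
  have "f' x = (\<lambda>h. h \<bullet> (\<chi> i. f' x (axis i 1)))" if "x \<in> slab" for x
  proof
    fix h
    have "linear (f' x)"
      using assms(1)[OF that] by (simp add: has_derivative_def bounded_linear.linear)
    then have "f' x (\<Sum>i\<in>UNIV. h $ i *\<^sub>R axis i 1) = (\<Sum>i\<in>UNIV. h $ i * f' x (axis i 1))"
      by (simp add: linear_sum linear_cmul)
    then show "f' x h = h \<bullet> (\<chi> i. f' x (axis i 1))"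
      using basis_expansion[of h] by (simp add: scalar_mult_eq_scaleR inner_vec_def)
  qed
  then show ?thesis
    using assms(2) has_derivative_eq_rhs[OF assms(1)] unfolding C1_grad_def
    by (auto intro!: continuous_on_vec_lambda)
qed

text \<open>The partial derivatives in the Euler system are identified with Frechet derivatives of
  the smooth solution, and the equations are then extended from the open to the closed slab.\<close>

lemma euler_solution_flow:
  assumes "T > 0" "euler_solution T u0 v q" "regular_solution T v q"
  obtains v' Dv Dq where "C1_euler_flow T v v' Dv q Dq"
proof -
  have C_on_1: "C_on 1 ({0..T} \<times> slab) (\<lambda>(t, x). v t x)" "C_on 1 ({0..T} \<times> slab) (\<lambda>(t, x). q t x)"
    using assms(3) by (auto simp: regular_solution_def smooth_on_def simp del: C_on.simps)
  obtain v' :: "real \<times> (real^3) \<Rightarrow> real \<times> (real^3) \<Rightarrow> real^3" where v':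
    "\<forall>t\<in>{0..T}. \<forall>x\<in>slab. (v t has_derivative (\<lambda>h. v' (t, x) (0, h))) (at x within slab)"
    "\<forall>t\<in>{0..T}. \<forall>x\<in>slab. ((\<lambda>t. v t x) has_vector_derivative v' (t, x) (1, 0)) (at t within {0..T})"
    "continuous_on ({0..T} \<times> slab) (\<lambda>(t, x). v t x)"
    "continuous_on ({0..T} \<times> slab) (\<lambda>p. v' p (1, 0))"
    "\<forall>t\<in>{0..T}. \<forall>i. continuous_on slab (\<lambda>x. v' (t, x) (0, axis i 1))"
    using C_on_1_slices[OF C_on_1(1)] by blast
  note v' = v'[rule_format]
  obtain q' :: "real \<times> (real^3) \<Rightarrow> real \<times> (real^3) \<Rightarrow> real" where q':
    "\<forall>t\<in>{0..T}. \<forall>x\<in>slab. (q t has_derivative (\<lambda>h. q' (t, x) (0, h))) (at x within slab)"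
    "\<forall>t\<in>{0..T}. \<forall>x\<in>slab. ((\<lambda>t. q t x) has_vector_derivative q' (t, x) (1, 0)) (at t within {0..T})"
    "continuous_on ({0..T} \<times> slab) (\<lambda>(t, x). q t x)"
    "continuous_on ({0..T} \<times> slab) (\<lambda>p. q' p (1, 0))"
    "\<forall>t\<in>{0..T}. \<forall>i. continuous_on slab (\<lambda>x. q' (t, x) (0, axis i 1))"
    using C_on_1_slices[OF C_on_1(2)] by blast
  note q' = q'[rule_format]
  define Dv :: "real \<Rightarrow> 3 \<Rightarrow> real^3 \<Rightarrow> real^3" where
    "Dv t j x = (\<chi> i. v' (t, x) (0, axis i 1) $ j)" for t j x
  define Dq :: "real \<Rightarrow> real^3 \<Rightarrow> real^3" where "Dq t x = (\<chi> i. q' (t, x) (0, axis i 1))" for t x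
  note euler = assms(2)[unfolded euler_solution_def]
  have v_C1: "C1_grad (\<lambda>x. v t x $ j) (Dv t j)" if t: "t \<in> {0..T}" for t j
    unfolding Dv_def
    by (rule C1_gradI[where f' = "\<lambda>x h. v' (t, x) (0, h) $ j"])
       (use v'(1,5)[OF t] in \<open>auto intro!: continuous_intros bounded_linear.has_derivative[OF bounded_linear_vec_nth]\<close>)
  have q_C1: "C1_grad (q t) (Dq t)" if t: "t \<in> {0..T}" for t
    unfolding Dq_def by (rule C1_gradI[OF q'(1,5)[OF t]])
  have cont: "continuous_on slab (v t)" "continuous_on slab (\<lambda>x. v' (t, x) (1, 0))"
    "continuous_on slab (Dv t j)" "continuous_on slab (Dq t)" if t: "t \<in> {0..T}" for t j
  proof -
    show "continuous_on slab (v t)"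
      using v'(1)[OF t] by (rule has_derivative_continuous_on)
    show "continuous_on slab (\<lambda>x. v' (t, x) (1, 0))"
      by (rule continuous_on_compose2[OF v'(4), of slab "\<lambda>x. (t, x)"]) (use t in \<open>auto intro!: continuous_intros\<close>)
  qed (use v_C1[OF t] q_C1[OF t] in \<open>auto dest: C1_gradD\<close>)
  have momentum: "v' (t, x) (1, 0) $ j + v t x \<bullet> Dv t j x + Dq t x $ j = 0"
    if t: "t \<in> {0..T}" and "x \<in> slab" for t x j
  \<comment> \<open>The left-hand side is continuous on the closed slab and zero in its interior,
    hence zero on the faces too.\<close>
  proof (rule continuous_constant_on_closure[where S = Omega1, OF _ _ \<open>x \<in> slab\<close>])
    show "continuous_on slab (\<lambda>x. v' (t, x) (1, 0) $ j + v t x \<bullet> Dv t j x + Dq t x $ j)"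
      by (intro continuous_intros cont[OF t])
    fix x assume x: "x \<in> Omega1"
    then have xs: "x \<in> slab" using closure_subset by blast
    have "vector_derivative (\<lambda>s. v s x) (at t within {0..T}) = v' (t, x) (1, 0)"
      by (rule vector_derivative_within[OF _ v'(2)[OF t xs]])
         (use t assms(1) in \<open>simp add: trivial_limit_within islimpt_Icc\<close>)
    moreover have "advection (v t) x $ j = v t x \<bullet> Dv t j x"
      by (simp add: advection_def pd_eqI[OF v'(1)[OF t xs] xs] inner_vec_def Dv_def)
    moreover have "gradient (q t) x $ j = Dq t x $ j"
      by (simp add: gradient_def C1_gradD(4)[OF q_C1[OF t] xs])
    ultimately show "v' (t, x) (1, 0) $ j + v t x \<bullet> Dv t j x + Dq t x $ j = 0"
      using euler t x by (metis vector_add_component zero_index)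
  qed
  have incompressible: "(\<Sum>i\<in>UNIV. Dv t i x $ i) = 0" if t: "t \<in> {0..T}" and "x \<in> slab" for t x
  proof (rule continuous_constant_on_closure[where S = Omega1, OF _ _ \<open>x \<in> slab\<close>])
    show "continuous_on slab (\<lambda>x. \<Sum>i\<in>UNIV. Dv t i x $ i)"
      by (intro continuous_intros cont[OF t])
    fix x assume x: "x \<in> Omega1"
    then have "x \<in> slab" using closure_subset by blast
    moreover have "divergence (v t) x = 0" using euler t x by blast
    ultimately show "(\<Sum>i\<in>UNIV. Dv t i x $ i) = 0"
      by (simp add: divergence_def C1_gradD(4)[OF v_C1[OF t]])
  qed
  have "C1_euler_flow T v (\<lambda>t x. v' (t, x) (1, 0)) Dv q Dq"
    using assms(1) v_C1 q_C1 v'(2,3,4) momentum incompressible euler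
    by unfold_locales (auto simp: case_prod_beta')
  then show thesis by (rule that)
qed

section \<open>Properties of the initial data and loss of matching\<close>

theorem mainTheorem2:
  shows "(\<forall>x\<in>Omega1. divergence v0 x = 0) \<and>
    (\<forall>x\<in>frontier Omega1. v0 x $ 3 = 0) \<and>
    (\<forall>x\<in>Omega1. laplacian q0 x =
        - (\<Sum>i\<in>UNIV. \<Sum>j\<in>UNIV. pd i (\<lambda>y. v0 y $ j) x * pd j (\<lambda>y. v0 y $ i) x)) \<and>
    (\<forall>x. x$3 = 1 \<or> x$3 = 2 \<longrightarrow> pd 3 q0 x = 0) \<and>
    (\<forall>x\<in>interface. q0 x = 0) \<and>
    stress_matching q0 (\<lambda>_. 0) \<and>
    (\<forall>(T::real) (v :: real \<Rightarrow> real^3 \<Rightarrow> real^3) (q :: real \<Rightarrow> real^3 \<Rightarrow> real).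
       T > 0 \<and> euler_solution T v0 v q \<and> regular_solution T v q \<longrightarrow>
       (\<exists>t0\<in>{0<..T}. \<forall>t\<in>{0<..<t0}.
          \<not> (\<exists>c::real. \<forall>x\<in>interface. q t x + c = 0)))"
proof (intro conjI ballI allI impI)
  fix x assume "x \<in> Omega1"
  then have x: "x \<in> slab" using closure_subset by blast
  show "divergence v0 x = 0"
    by (rule divergence_v0[OF x])
  show "laplacian q0 x = - (\<Sum>i\<in>UNIV. \<Sum>j\<in>UNIV. pd i (\<lambda>y. v0 y $ j) x * pd j (\<lambda>y. v0 y $ i) x)"
    by (rule laplacian_q0[OF x])
next
  show "v0 x $ 3 = 0" for x by (simp add: v0_def)
next
  fix x :: "real^3" assume x: "x$3 = 1 \<or> x$3 = 2"
  then have "x \<in> slab" by (auto simp: slab_eq)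
  with x show "pd 3 q0 x = 0"
    by (auto simp: C1_gradD(4)[OF C1_grad_q0] grad_q0_def)
next
  show "q0 x = 0" if "x \<in> interface" for x
    using that by (simp add: q0_def interface_def)
next
  show "stress_matching q0 (\<lambda>_. 0)"
    unfolding stress_matching_def
  proof
    fix x assume "x \<in> interface"
    then have x: "x$3 = 1" by (simp add: interface_def)
    have "closure elastic_layer = {x. 0 \<le> x$3 \<and> x$3 \<le> 1}"
      unfolding elastic_layer_def by (rule closure_open_slab) simp
    \<comment> \<open>The interface is the top face of the elastic layer, so the normal derivative
      of the zero displacement is one-sided from below; nontriviality of the filter guarantees that
      its value is 0.\<close>
    then have "at 0 within {s. x + s *\<^sub>R axis 3 1 \<in> closure elastic_layer} \<noteq> bot"
      using at_zero_within_line_neq_bot[of 0 x 1 3] x by simp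
    then have "partial_within (closure elastic_layer) 3 (\<lambda>_. 0 :: real) x = 0"
      unfolding partial_within_def by (rule vector_derivative_within) simp
    then show "q0 x = partial_within (closure elastic_layer) 3 (\<lambda>_. 0) x"
      using x by (simp add: q0_def)
  qed
next
  fix T v q assume "T > 0 \<and> euler_solution T v0 v q \<and> regular_solution T v q"
  then have T: "T > 0" and e: "euler_solution T v0 v q" and r: "regular_solution T v q" by auto
  obtain v' Dv Dq where "C1_euler_flow T v v' Dv q Dq"
    using euler_solution_flow[OF T e r] .
  then interpret C1_euler_flow T v v' Dv q Dq .
  show "\<exists>t0\<in>{0<..T}. \<forall>t\<in>{0<..<t0}. \<not> (\<exists>c. \<forall>x\<in>interface. q t x + c = 0)"
    by (rule not_matching) (use e in \<open>simp add: euler_solution_def\<close>)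
qed

end
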